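(* Let $\mathscr S$ be the set of all $\mathcal S\in\mathrm{TDC}\cap\mathrm{OSC}^{\mathrm E}_1$ that satisfy the convex open set condition and are orthogonal homogeneous. For every $\mathcal S\in\mathscr S$ we have $I_{\mathcal S}=\mathbb Z[p_{\mathcal S}]$. As a result, $\mathscr S\subset\mathrm{PI}$, where $\mathrm{PI}$ is the set of all $\mathcal S\in\mathrm{TDC}\cap\mathrm{OSC}^{\mathrm E}_1$ such that $I_{\mathcal S}$ is a principal ideal of $\mathbb Z[p_{\mathcal S}]$.
   Context: An IFS is a finite family $\mathcal S=\{S_1,\dots,S_N\}$, $N\ge2$, of contracting similarities of a Euclidean space $\mathbb R^d$, where $S_i$ has ratio $r_i\in(0,1)$, i.e. $|S_i(x)-S_i(y)|=r_i|x-y|$. $E_{\mathcal S}$ is the unique nonempty compact set with $E_{\mathcal S}=\bigcup_i S_i(E_{\mathcal S})$. A nonempty bounded open set $O$ satisfies the open set condition (OSC) for $\mathcal S$ if the sets $S_i(O)$ are pairwise disjoint and contained in $O$; $\mathcal S$ satisfies the OSC if such an $O$ exists, and satisfies the convex open set condition if such an $O$ exists that is convex. $\mathcal S$ on $\mathbb R^d$ is orthogonal homogeneous if there is a $d\times d$ orthogonal matrix $A$ such that each $S_i$ has the form $S_i(x)=r_iAx+b_i$ with $r_i\in(0,1)$, $b_i\in\mathbb R^d$. The ratios are commensurable if there is $r_{\mathcal S}\in(0,1)$ (the ratio root) with $r_i=r_{\mathcal S}^{\lambda_i}$ for positive integers $\lambda_i$ with $\gcd(\lambda_1,\dots,\lambda_N)=1$.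 $\mathrm{TDC}\cap\mathrm{OSC}^{\mathrm E}_1$ denotes the set of IFSs on Euclidean spaces that satisfy the OSC, have commensurable ratios, and whose $E_{\mathcal S}$ is totally disconnected. For such $\mathcal S$ let $s=\dim_H E_{\mathcal S}$ (equivalently $\sum_i r_i^s=1$), $\mu_{\mathcal S}=\mathcal H^s|_{E_{\mathcal S}}/\mathcal H^s(E_{\mathcal S})$, $p_{\mathcal S}=r_{\mathcal S}^s$, and let $\mathbb Z[p_{\mathcal S}]\subset\mathbb R$ be the ring generated by $p_{\mathcal S}$ over $\mathbb Z$. An interior separated set of $E_{\mathcal S}$ is a compact $F\subset E_{\mathcal S}$ such that $E_{\mathcal S}\setminus F$ is also compact and $F\subset O$ for some open set $O$ satisfying the OSC for $\mathcal S$; one has $\mu_{\mathcal S}(F)\in\mathbb Z[p_{\mathcal S}]$. $I_{\mathcal S}$ is the ideal of $\mathbb Z[p_{\mathcal S}]$ generated by $\{\mu_{\mathcal S}(F): F \text{ an interior separated set of } E_{\mathcal S}\}$. *)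

theory Defs
  imports "HOL-Analysis.Analysis" "HOL-Algebra.Algebraic_Closure_Type" "HOL-Algebra.Generated_Rings"
begin

text \<open>The \<open>s\<close>-th power of the diameter, with the conventions (relevant only for \<open>s = 0\<close>) that it
  is \<open>0\<close> for the empty set and that \<open>0\<close> to the power \<open>0\<close> is \<open>1\<close>, unlike
  \<^term>\<open>(0::real) powr 0\<close>. Thus the measure for \<open>s = 0\<close> is the counting measure.\<close>

definition diam_powr :: "real \<Rightarrow> 'a::metric_space set \<Rightarrow> real" where
  "diam_powr s U = (if U = {} then 0 else if s = 0 then 1 else diameter U powr s)"

text \<open>Boundedness is required explicitly because \<^term>\<open>diameter U\<close> is a junk value for unbounded
  \<open>U\<close>. Finite covers are included, since \<open>U i\<close> may be empty.\<close>

definition hausdorff_premeasure :: "real \<Rightarrow> real \<Rightarrow> 'a::metric_space set \<Rightarrow> ennreal" where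
  "hausdorff_premeasure s \<delta> A =
     (INF U \<in> {U :: nat \<Rightarrow> 'a set. A \<subseteq> (\<Union>i. U i) \<and> (\<forall>i. bounded (U i) \<and> diameter (U i) \<le> \<delta>)}.
        (\<Sum>i. ennreal (diam_powr s (U i))))"

text \<open>The outer measure on all subsets; it is only applied to compact sets below.\<close>

definition hausdorff_measure :: "real \<Rightarrow> 'a::metric_space set \<Rightarrow> ennreal" where
  "hausdorff_measure s A = (SUP \<delta> \<in> {0<..}. hausdorff_premeasure s \<delta> A)"

definition hausdorff_dim :: "'a::euclidean_space set \<Rightarrow> real" where
  "hausdorff_dim A = Inf {s. 0 \<le> s \<and> hausdorff_measure s A = 0}"

text \<open>A finite family of maps is a list, so repetitions are not excluded a priori.\<close>

type_synonym 'a ifs = "('a \<Rightarrow> 'a) list"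

definition similarity_with :: "real \<Rightarrow> ('a::metric_space \<Rightarrow> 'a) \<Rightarrow> bool" where
  "similarity_with r f \<longleftrightarrow> (\<forall>x y. dist (f x) (f y) = r * dist x y)"

definition is_ifs :: "'a::euclidean_space ifs \<Rightarrow> bool" where
  "is_ifs S \<longleftrightarrow> 2 \<le> length S \<and> (\<forall>f\<in>set S. \<exists>r. 0 < r \<and> r < 1 \<and> similarity_with r f)"

definition ratio :: "('a::euclidean_space \<Rightarrow> 'a) \<Rightarrow> real" where
  "ratio f = (THE r. similarity_with r f)"

lemma ratio_eq:
  fixes f :: "'a::euclidean_space \<Rightarrow> 'a"
  assumes "similarity_with r f"
  shows "ratio f = r"
proof -
  obtain b :: 'a where "b \<in> Basis" using nonempty_Basis by blast
  then have b: "dist b 0 = 1" by simp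
  have "q = r" if "similarity_with q f" for q
    using assms that b unfolding similarity_with_def by (metis mult.right_neutral)
  with assms show ?thesis unfolding ratio_def by blast
qed

definition attractor :: "'a::euclidean_space ifs \<Rightarrow> 'a set" where
  "attractor S = (THE E. E \<noteq> {} \<and> compact E \<and> E = (\<Union>f\<in>set S. f ` E))"

definition osc_set :: "'a::euclidean_space ifs \<Rightarrow> 'a set \<Rightarrow> bool" where
  "osc_set S U \<longleftrightarrow> U \<noteq> {} \<and> bounded U \<and> open U \<and>
     (\<forall>i<length S. (S ! i) ` U \<subseteq> U) \<and>
     (\<forall>i<length S. \<forall>j<length S. i \<noteq> j \<longrightarrow> (S ! i) ` U \<inter> (S ! j) ` U = {})"

definition open_set_condition :: "'a::euclidean_space ifs \<Rightarrow> bool" where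
  "open_set_condition S \<longleftrightarrow> (\<exists>U. osc_set S U)"

definition convex_open_set_condition :: "'a::euclidean_space ifs \<Rightarrow> bool" where
  "convex_open_set_condition S \<longleftrightarrow> (\<exists>U. osc_set S U \<and> convex U)"

definition orthogonal_homogeneous :: "(real^'n) ifs \<Rightarrow> bool" where
  "orthogonal_homogeneous S \<longleftrightarrow>
     (\<exists>A :: real^'n^'n. orthogonal_matrix A \<and>
        (\<forall>f\<in>set S. \<exists>r b. 0 < r \<and> r < 1 \<and> (\<forall>x. f x = r *\<^sub>R (A *v x) + b)))"

definition is_ratio_root :: "'a::euclidean_space ifs \<Rightarrow> real \<Rightarrow> bool" where
  "is_ratio_root S r \<longleftrightarrow> 0 < r \<and> r < 1 \<and>
     (\<exists>l :: nat \<Rightarrow> nat. (\<forall>i<length S. 0 < l i \<and> ratio (S ! i) = r ^ l i) \<and>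
        Gcd (l ` {..<length S}) = 1)"

definition commensurable_ratios :: "'a::euclidean_space ifs \<Rightarrow> bool" where
  "commensurable_ratios S \<longleftrightarrow> (\<exists>r. is_ratio_root S r)"

definition ratio_root :: "'a::euclidean_space ifs \<Rightarrow> real" where
  "ratio_root S = (THE r. is_ratio_root S r)"

lemma ratio_root_eq:
  fixes S :: "'a::euclidean_space ifs"
  assumes "is_ratio_root S r"
  shows "ratio_root S = r"
proof -
  have "q = r" if q: "is_ratio_root S q" for q
  proof -
    define I where "I = {..<length S}"
    obtain l where r: "0 < r" "r < 1" and l: "\<And>i. i \<in> I \<Longrightarrow> 0 < l i \<and> ratio (S ! i) = r ^ l i"
      and gl: "Gcd (l ` I) = (1::nat)"
      using assms unfolding is_ratio_root_def I_def by auto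
    obtain m where q: "0 < q" "q < 1" and m: "\<And>i. i \<in> I \<Longrightarrow> 0 < m i \<and> ratio (S ! i) = q ^ m i"
      and gm: "Gcd (m ` I) = (1::nat)"
      using q unfolding is_ratio_root_def I_def by auto
    have ne: "I \<noteq> {}" using gl by auto
    then obtain k where k: "k \<in> I" by blast
    have eq: "real (l i) * ln r = real (m i) * ln q" if "i \<in> I" for i
      using l[OF that] m[OF that] r q by (metis ln_realpow)
    have neg: "ln r < 0" "ln q < 0" using r q by simp_all
    have cross: "m k * l i = l k * m i" if "i \<in> I" for i
    proof -
      have "(real (m k) * real (l i)) * (ln r * ln q) = (real (l k) * real (m i)) * (ln r * ln q)"
        using eq[OF that] eq[OF k] by (metis (no_types, opaque_lifting) mult.assoc mult.commute)
      then have "real (m k) * real (l i) = real (l k) * real (m i)" using neg by simp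
      then show ?thesis by (metis of_nat_eq_iff of_nat_mult)
    qed
    have "m k = Gcd ((*) (m k) ` l ` I)" using gl by (simp add: Gcd_mult)
    also have "(*) (m k) ` l ` I = (*) (l k) ` m ` I"
      using cross by (auto simp: image_image)
    also have "Gcd \<dots> = l k" using gm by (simp add: Gcd_mult)
    finally have "ln r = ln q" using eq[OF k] l[OF k] by simp
    then show ?thesis using r q by simp
  qed
  with assms show ?thesis unfolding ratio_root_def by blast
qed

definition totally_disconnected :: "'a::topological_space set \<Rightarrow> bool" where
  "totally_disconnected E \<longleftrightarrow> (\<forall>C. C \<subseteq> E \<and> connected C \<longrightarrow> (\<exists>x. C \<subseteq> {x}))"

definition TDC_OSC1 :: "'a::euclidean_space ifs set" where
  "TDC_OSC1 = {S. is_ifs S \<and> open_set_condition S \<and> commensurable_ratios S \<and>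
     totally_disconnected (attractor S)}"

definition attractor_dim :: "'a::euclidean_space ifs \<Rightarrow> real" where
  "attractor_dim S = hausdorff_dim (attractor S)"

definition natural_measure :: "'a::euclidean_space ifs \<Rightarrow> 'a set \<Rightarrow> real" where
  "natural_measure S A =
     enn2real (hausdorff_measure (attractor_dim S) (A \<inter> attractor S)) /
     enn2real (hausdorff_measure (attractor_dim S) (attractor S))"

definition ratio_power :: "'a::euclidean_space ifs \<Rightarrow> real" where
  "ratio_power S = ratio_root S powr attractor_dim S"

definition int_adjoin :: "real \<Rightarrow> real ring" where
  "int_adjoin p = (ring_of_type_algebra :: real ring)
     \<lparr>carrier := generate_ring (ring_of_type_algebra :: real ring) {p}\<rparr>"

definition interior_separated :: "'a::euclidean_space ifs \<Rightarrow> 'a set \<Rightarrow> bool" where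
  "interior_separated S F \<longleftrightarrow> F \<subseteq> attractor S \<and> compact F \<and> compact (attractor S - F) \<and>
     (\<exists>U. osc_set S U \<and> F \<subseteq> U)"

definition measure_ideal :: "'a::euclidean_space ifs \<Rightarrow> real set" where
  "measure_ideal S = genideal (int_adjoin (ratio_power S))
     {natural_measure S F | F. interior_separated S F}"

definition PI_class :: "'a::euclidean_space ifs set" where
  "PI_class = {S \<in> TDC_OSC1. principalideal (measure_ideal S) (int_adjoin (ratio_power S))}"

definition convex_orthogonal_class :: "(real^'n) ifs set" where
  "convex_orthogonal_class = {S \<in> TDC_OSC1. convex_open_set_condition S \<and> orthogonal_homogeneous S}"

end

theory Submission
  imports Defs
begin

text \<open>
  Let \<open>U\<close> be a convex set for the OSC and \<open>T\<close> the transpose of the common orthogonal part.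
  Two pieces \<open>S\<^sub>v(E)\<close>, \<open>S\<^sub>w(E)\<close> of level \<open>n\<close> are separated by a hyperplane with some normal vector
  \<open>g\<close>, and since all maps of level \<open>n\<close> have the same linear part up to scaling, the pieces touch
  only where \<open>T\<^sup>n g\<close> is an outer normal vector of \<open>U\<close>. Take a clopen part \<open>C\<close> of \<open>E\<close> in a suitable open
  set for the OSC, and split it into pieces of level \<open>n\<close>. For \<open>x\<close> in \<open>E\<close>, a piece \<open>S\<^sub>v(E)\<close> in \<open>C\<close> such
  that \<open>S\<^sub>v(x)\<close> is furthest out with respect to the normal cone at \<open>x\<close> touches no other piece at
  \<open>S\<^sub>v(x)\<close>. Hence \<open>S\<^sub>v(F)\<close> is an interior separated set for every small clopen \<open>F\<close> around \<open>x\<close>, and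
  \<open>\<mu>(F)\<close> is \<open>\<mu>(S\<^sub>v(F))\<close> up to a power of \<open>p\<close>, which is a unit of the ring because the powers
  \<open>r\<^sub>i\<^sup>s\<close> of \<open>p\<close> add up to \<open>1\<close>. Partitioning \<open>E\<close> into such \<open>F\<close> puts \<open>1 = \<mu>(E)\<close> into the ideal.

  The open set has to meet \<open>E\<close>, which \<open>U\<close> itself may fail to do: it is generated by a small ball
  around a point of \<open>E\<close> that lies in the relative interior of the convex hull of \<open>E\<close>.
\<close>

section \<open>Hausdorff measure\<close>

text \<open>A functional \<open>g\<close> acts on a piece of level \<open>n\<close> as
  \<open>(T ^^ n) g\<close> acts on \<open>E\<close>, up to a positive ratio. The transported
  direction depends on the level alone, which is why words of equal length are compared although
  their ratios differ. Convexity of \<open>U\<close> provides the separating functionals; openness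
  makes comparisons strict, since no nonzero functional is constant on \<open>U\<close>.

  \<open>E\<close> may lie in the boundary of \<open>U\<close>, like a Cantor set on one edge of a
  square, so a point deep in the convex hull has to be found in \<open>E\<close> itself. A suitable
  prefix moves a point away from one family of supporting hyperplanes, but putting further letters
  in front rotates the directions in question. Blocks of a length \<open>L\<close> for which
  \<open>T ^^ L\<close> is nearly the identity keep this under control.

  Hausdorff measure is handled as an outer measure, additive on sets at positive distance, which
  covers clopen parts of \<open>E\<close>. Its positivity on \<open>E\<close> comes from finite sums
  over the words of one level, which stand in for a self-similar measure.\<close>

lemma hausdorff_premeasure_le:
  assumes "A \<subseteq> (\<Union>i. U i)" "\<And>i. bounded (U i)" "\<And>i. diameter (U i) \<le> \<delta>"
  shows "hausdorff_premeasure s \<delta> A \<le> (\<Sum>i. ennreal (diam_powr s (U i)))"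
  unfolding hausdorff_premeasure_def using assms by (intro INF_lower) auto

lemma hausdorff_premeasure_ge:
  assumes "\<And>U. A \<subseteq> (\<Union>i. U i) \<Longrightarrow> (\<And>i. bounded (U i)) \<Longrightarrow> (\<And>i. diameter (U i) \<le> \<delta>)
    \<Longrightarrow> c \<le> (\<Sum>i::nat. ennreal (diam_powr s (U i)))"
  shows "c \<le> hausdorff_premeasure s \<delta> A"
  unfolding hausdorff_premeasure_def using assms by (intro INF_greatest) auto

lemma hausdorff_premeasure_less:
  assumes "hausdorff_premeasure s \<delta> A < c"
  obtains U :: "nat \<Rightarrow> 'a::metric_space set" where "A \<subseteq> (\<Union>i. U i)" "\<And>i. bounded (U i)"
    "\<And>i. diameter (U i) \<le> \<delta>" "(\<Sum>i. ennreal (diam_powr s (U i))) < c"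
  using assms unfolding hausdorff_premeasure_def INF_less_iff by blast

lemma hausdorff_premeasure_mono:
  "A \<subseteq> B \<Longrightarrow> hausdorff_premeasure s \<delta> A \<le> hausdorff_premeasure s \<delta> B"
  by (rule hausdorff_premeasure_ge) (auto intro!: hausdorff_premeasure_le)

lemma hausdorff_premeasure_antimono:
  "\<delta> \<le> \<delta>' \<Longrightarrow> hausdorff_premeasure s \<delta>' A \<le> hausdorff_premeasure s \<delta> A"
  by (rule hausdorff_premeasure_ge) (auto intro!: hausdorff_premeasure_le intro: order_trans)

lemma diam_powr_empty [simp]: "diam_powr s {} = 0"
  by (simp add: diam_powr_def)

lemma diam_powr_nonneg [simp]: "0 \<le> diam_powr s U"
  by (simp add: diam_powr_def)

lemma hausdorff_premeasure_single:
  assumes "bounded A" "diameter A \<le> \<delta>" "0 \<le> \<delta>"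
  shows "hausdorff_premeasure s \<delta> A \<le> ennreal (diam_powr s A)"
proof -
  have "hausdorff_premeasure s \<delta> A
      \<le> (\<Sum>i::nat. ennreal (diam_powr s (if i = 0 then A else {})))"
    using assms by (intro hausdorff_premeasure_le) auto
  also have "\<dots> = (\<Sum>i\<in>{0::nat}. ennreal (diam_powr s (if i = 0 then A else {})))"
    by (rule suminf_finite) auto
  finally show ?thesis by simp
qed

lemma hausdorff_premeasure_empty [simp]: "0 \<le> \<delta> \<Longrightarrow> hausdorff_premeasure s \<delta> {} = 0"
  using hausdorff_premeasure_single[of "{}" \<delta> s] by simp

text \<open>Merges two countable covers into one sequence: even indices run through the first, odd
  ones through the second.\<close>

lemma suminf_interleave:
  fixes f g :: "nat \<Rightarrow> ennreal"
  shows "(\<Sum>i. if even i then f (i div 2) else g (i div 2)) = (\<Sum>i. f i) + (\<Sum>i. g i)"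
proof -
  let ?h = "\<lambda>i. if even i then f (i div 2) else g (i div 2)"
  have eq: "(\<Sum>i<2 * n. ?h i) = (\<Sum>i<n. f i) + (\<Sum>i<n. g i)" for n
    by (induction n) (simp_all add: algebra_simps)
  have "(\<lambda>n. \<Sum>i<n. ?h i) \<longlonglongrightarrow> (\<Sum>i. ?h i)"
    by (intro summable_LIMSEQ summableI)
  then have "(\<lambda>n. \<Sum>i<2 * n. ?h i) \<longlonglongrightarrow> (\<Sum>i. ?h i)"
    by (rule LIMSEQ_subseq_LIMSEQ[of _ _ "\<lambda>n. 2 * n", unfolded comp_def]) (simp add: strict_mono_def)
  moreover have "(\<lambda>n. (\<Sum>i<n. f i) + (\<Sum>i<n. g i)) \<longlonglongrightarrow> (\<Sum>i. f i) + (\<Sum>i. g i)"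
    by (intro tendsto_add summable_LIMSEQ summableI)
  ultimately show ?thesis unfolding eq by (rule LIMSEQ_unique)
qed

lemma hausdorff_premeasure_Un:
  "hausdorff_premeasure s \<delta> (A \<union> B) \<le> hausdorff_premeasure s \<delta> A + hausdorff_premeasure s \<delta> B"
proof (rule ennreal_le_epsilon)
  fix e :: real
  assume fin: "hausdorff_premeasure s \<delta> A + hausdorff_premeasure s \<delta> B < top_class.top" and "0 < e"
  have ex: "\<exists>U. C \<subseteq> (\<Union>i. U i) \<and> (\<forall>i. bounded (U i)) \<and> (\<forall>i. diameter (U i) \<le> \<delta>) \<and>
      (\<Sum>i::nat. ennreal (diam_powr s (U i))) < hausdorff_premeasure s \<delta> C + ennreal (e / 2)"
    if "hausdorff_premeasure s \<delta> C < top_class.top" for C :: "'a set"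
  proof -
    have "hausdorff_premeasure s \<delta> C < hausdorff_premeasure s \<delta> C + ennreal (e / 2)"
      using that \<open>0 < e\<close> by (simp add: ennreal_add_left_cancel_less[of _ 0, simplified])
    then show ?thesis by (rule hausdorff_premeasure_less) blast
  qed
  have "hausdorff_premeasure s \<delta> A < top_class.top" "hausdorff_premeasure s \<delta> B < top_class.top"
    using fin by (auto simp: less_top)
  note ex = ex[OF this(1)] ex[OF this(2)]
  obtain U where U: "A \<subseteq> (\<Union>i. U i)" "\<And>i. bounded (U i)" "\<And>i. diameter (U i) \<le> \<delta>"
      "(\<Sum>i::nat. ennreal (diam_powr s (U i))) < hausdorff_premeasure s \<delta> A + ennreal (e / 2)"
    using ex(1) by blast
  obtain V where V: "B \<subseteq> (\<Union>i. V i)" "\<And>i. bounded (V i)" "\<And>i. diameter (V i) \<le> \<delta>"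
      "(\<Sum>i::nat. ennreal (diam_powr s (V i))) < hausdorff_premeasure s \<delta> B + ennreal (e / 2)"
    using ex(2) by blast
  let ?W = "\<lambda>i. if even i then U (i div 2) else V (i div 2)"
  have "x \<in> (\<Union>i. ?W i)" if "x \<in> A \<union> B" for x
  proof -
    from that consider i where "x \<in> U i" | i where "x \<in> V i" using U V by blast
    then show ?thesis
    proof cases
      case (1 i) then have "x \<in> ?W (2 * i)" by simp then show ?thesis by blast
    next
      case (2 i) then have "x \<in> ?W (2 * i + 1)" by simp then show ?thesis by blast
    qed
  qed
  then have "hausdorff_premeasure s \<delta> (A \<union> B) \<le> (\<Sum>i. ennreal (diam_powr s (?W i)))"
    using U(2,3) V(2,3) by (intro hausdorff_premeasure_le subsetI) (assumption | simp)+
  also have "\<dots> = (\<Sum>i. if even i then ennreal (diam_powr s (U (i div 2)))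
      else ennreal (diam_powr s (V (i div 2))))"
    by (intro suminf_cong) simp
  also have "\<dots> = (\<Sum>i. ennreal (diam_powr s (U i))) + (\<Sum>i. ennreal (diam_powr s (V i)))"
    by (rule suminf_interleave)
  also have "\<dots> \<le> (hausdorff_premeasure s \<delta> A + ennreal (e / 2)) + (hausdorff_premeasure s \<delta> B + ennreal (e / 2))"
    using U(4) V(4) by (intro add_mono less_imp_le)
  also have "\<dots> = hausdorff_premeasure s \<delta> A + hausdorff_premeasure s \<delta> B + (ennreal (e / 2) + ennreal (e / 2))"
    by (simp only: ac_simps)
  also have "ennreal (e / 2) + ennreal (e / 2) = ennreal e"
    using \<open>0 < e\<close> by (simp flip: ennreal_plus)
  finally show "hausdorff_premeasure s \<delta> (A \<union> B)
      \<le> hausdorff_premeasure s \<delta> A + hausdorff_premeasure s \<delta> B + ennreal e" .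
qed

lemma hausdorff_premeasure_UN:
  assumes "finite I" "0 \<le> \<delta>"
  shows "hausdorff_premeasure s \<delta> (\<Union>i\<in>I. Z i) \<le> (\<Sum>i\<in>I. hausdorff_premeasure s \<delta> (Z i))"
  using assms(1)
proof (induction I)
  case (insert i I)
  have "hausdorff_premeasure s \<delta> (\<Union>j\<in>insert i I. Z j)
      \<le> hausdorff_premeasure s \<delta> (Z i) + hausdorff_premeasure s \<delta> (\<Union>j\<in>I. Z j)"
    using hausdorff_premeasure_Un[of s \<delta> "Z i" "\<Union>j\<in>I. Z j"] by simp
  also have "\<dots> \<le> hausdorff_premeasure s \<delta> (Z i) + (\<Sum>j\<in>I. hausdorff_premeasure s \<delta> (Z j))"
    by (rule add_left_mono[OF insert.IH])
  also have "\<dots> = (\<Sum>j\<in>insert i I. hausdorff_premeasure s \<delta> (Z j))"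
    by (rule sum.insert[OF insert.hyps, symmetric])
  finally show ?case .
qed (use assms in simp)

lemma hausdorff_measure_le:
  assumes "\<And>\<delta>. 0 < \<delta> \<Longrightarrow> hausdorff_premeasure s \<delta> A \<le> c"
  shows "hausdorff_measure s A \<le> c"
  unfolding hausdorff_measure_def using assms by (intro SUP_least) auto

lemma hausdorff_premeasure_le_measure:
  "0 < \<delta> \<Longrightarrow> hausdorff_premeasure s \<delta> A \<le> hausdorff_measure s A"
  unfolding hausdorff_measure_def by (intro SUP_upper) auto

lemma hausdorff_measure_empty [simp]: "hausdorff_measure s {} = 0"
proof -
  have "hausdorff_measure s {} \<le> 0" by (rule hausdorff_measure_le) simp
  then show ?thesis by simp
qed

lemma hausdorff_measure_mono: "A \<subseteq> B \<Longrightarrow> hausdorff_measure s A \<le> hausdorff_measure s B"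
  by (rule hausdorff_measure_le)
     (metis hausdorff_premeasure_mono hausdorff_premeasure_le_measure order_trans)

lemma hausdorff_measure_Un:
  "hausdorff_measure s (A \<union> B) \<le> hausdorff_measure s A + hausdorff_measure s B"
  by (rule hausdorff_measure_le)
     (meson hausdorff_premeasure_Un hausdorff_premeasure_le_measure add_mono order_trans)

lemma hausdorff_measure_UN:
  assumes "finite I"
  shows "hausdorff_measure s (\<Union>i\<in>I. Z i) \<le> (\<Sum>i\<in>I. hausdorff_measure s (Z i))"
proof (rule hausdorff_measure_le)
  fix \<delta> :: real assume "0 < \<delta>"
  then have "hausdorff_premeasure s \<delta> (\<Union>i\<in>I. Z i) \<le> (\<Sum>i\<in>I. hausdorff_premeasure s \<delta> (Z i))"
    using assms by (intro hausdorff_premeasure_UN) auto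
  also have "\<dots> \<le> (\<Sum>i\<in>I. hausdorff_measure s (Z i))"
    using \<open>0 < \<delta>\<close> by (intro sum_mono hausdorff_premeasure_le_measure)
  finally show "hausdorff_premeasure s \<delta> (\<Union>i\<in>I. Z i) \<le> (\<Sum>i\<in>I. hausdorff_measure s (Z i))" .
qed

text \<open>A set of diameter less than \<open>d\<close> meets at most one of \<open>A\<close> and
  \<open>B\<close>, so every sufficiently fine cover of the union splits into a cover of
  \<open>A\<close> and one of \<open>B\<close>.\<close>

lemma hausdorff_measure_separated:
  assumes d: "0 < d" "\<And>x y. x \<in> A \<Longrightarrow> y \<in> B \<Longrightarrow> d \<le> dist x y"
  shows "hausdorff_measure s (A \<union> B) = hausdorff_measure s A + hausdorff_measure s B"
proof (rule antisym[OF hausdorff_measure_Un])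
  have *: "hausdorff_premeasure s \<delta> A + hausdorff_premeasure s \<delta> B \<le> hausdorff_premeasure s \<delta> (A \<union> B)"
    if \<delta>: "\<delta> < d" "0 < \<delta>" for \<delta>
  proof (rule hausdorff_premeasure_ge)
    fix U :: "nat \<Rightarrow> 'a set"
    assume U: "A \<union> B \<subseteq> (\<Union>i. U i)" "\<And>i. bounded (U i)" "\<And>i. diameter (U i) \<le> \<delta>"
    define V where "V Z i = (if U i \<inter> Z = {} then {} else U i)" for Z i
    have V: "hausdorff_premeasure s \<delta> Z \<le> (\<Sum>i. ennreal (diam_powr s (V Z i)))" if "Z \<subseteq> A \<union> B" for Z
      using U that \<delta> by (intro hausdorff_premeasure_le) (fastforce simp: V_def)+
    have "V A i = {} \<or> V B i = {}" for i
    proof (rule ccontr)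
      assume "\<not> ?thesis"
      then obtain x y where "x \<in> U i" "x \<in> A" "y \<in> U i" "y \<in> B" by (auto simp: V_def split: if_splits)
      then have "d \<le> \<delta>" using d diameter_bounded_bound[OF U(2)] U(3) by (meson order_trans)
      then show False using \<delta> by simp
    qed
    moreover have "V Z i = {} \<or> V Z i = U i" for Z i by (simp add: V_def)
    ultimately have "ennreal (diam_powr s (V A i)) + ennreal (diam_powr s (V B i)) \<le> ennreal (diam_powr s (U i))"
      for i by (metis add.left_neutral add.right_neutral diam_powr_empty ennreal_0 order_refl zero_le)
    then have "(\<Sum>i. ennreal (diam_powr s (V A i)) + ennreal (diam_powr s (V B i)))
        \<le> (\<Sum>i. ennreal (diam_powr s (U i)))"
      by (intro suminf_le) auto
    moreover have "hausdorff_premeasure s \<delta> A + hausdorff_premeasure s \<delta> B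
        \<le> (\<Sum>i. ennreal (diam_powr s (V A i)) + ennreal (diam_powr s (V B i)))"
      unfolding suminf_add[OF summableI summableI, symmetric] by (intro add_mono V) auto
    ultimately show "hausdorff_premeasure s \<delta> A + hausdorff_premeasure s \<delta> B \<le> (\<Sum>i. ennreal (diam_powr s (U i)))"
      by (rule order_trans[rotated])
  qed
  \<comment> \<open>The two scales are decoupled so that the suprema over \<open>a\<close> and
    \<open>b\<close> can be taken one after the other.\<close>
  have ex: "hausdorff_premeasure s a A + hausdorff_premeasure s b B \<le> hausdorff_measure s (A \<union> B)"
    if "0 < a" "0 < b" for a b
  proof -
    define \<delta> where "\<delta> = min (min a b) (d / 2)"
    have \<delta>: "0 < \<delta>" "\<delta> \<le> a" "\<delta> \<le> b" "\<delta> < d" using that d by (auto simp: \<delta>_def min_def)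
    have "hausdorff_premeasure s a A + hausdorff_premeasure s b B
        \<le> hausdorff_premeasure s \<delta> A + hausdorff_premeasure s \<delta> B"
      using \<delta> by (intro add_mono hausdorff_premeasure_antimono)
    also have "\<dots> \<le> hausdorff_measure s (A \<union> B)"
      using * hausdorff_premeasure_le_measure \<delta> by (meson order_trans)
    finally show ?thesis .
  qed
  have "hausdorff_premeasure s a A + hausdorff_measure s B \<le> hausdorff_measure s (A \<union> B)" if "0 < a" for a
    unfolding hausdorff_measure_def[of s B]
    by (subst ennreal_SUP_add_right) (auto intro!: SUP_least ex that)
  then show "hausdorff_measure s A + hausdorff_measure s B \<le> hausdorff_measure s (A \<union> B)"
    unfolding hausdorff_measure_def[of s A]
    by (subst ennreal_SUP_add_left[symmetric]) (auto intro!: SUP_least)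
qed

lemma similarity_bounded_diameter:
  fixes f :: "'a::real_normed_vector \<Rightarrow> 'a"
  assumes "similarity_with r f" "0 \<le> r" "bounded U"
  shows "bounded (f ` U)" "diameter (f ` U) \<le> r * diameter U"
proof -
  have le: "dist (f x) (f y) \<le> r * diameter U" if "x \<in> U" "y \<in> U" for x y
    using assms that diameter_bounded_bound[OF \<open>bounded U\<close> that]
    by (auto simp: similarity_with_def mult_left_mono)
  show "bounded (f ` U)"
  proof (cases "U = {}")
    case False
    then obtain x where "x \<in> U" by blast
    then show ?thesis unfolding bounded_def using le by blast
  qed simp
  show "diameter (f ` U) \<le> r * diameter U"
    using le assms diameter_ge_0[OF \<open>bounded U\<close>]
    by (intro diameter_le) (auto simp: dist_norm)
qed

text \<open>Covers of \<open>A\<close> are mapped to covers of its image. For pieces of the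
  attractor, this upper bound is later sharpened to an equality by \<open>\<mu>_eqI\<close>.\<close>

lemma hausdorff_measure_similarity_le:
  fixes f :: "'a::euclidean_space \<Rightarrow> 'a"
  assumes f: "similarity_with r f" "0 < r" and "0 < s"
  shows "hausdorff_measure s (f ` A) \<le> ennreal (r powr s) * hausdorff_measure s A"
proof (rule hausdorff_measure_le)
  \<comment> \<open>Cancellation in \<open>ennreal\<close>: the factor is moved to the left so that
    the infimum over covers of \<open>A\<close> can be bounded from below.\<close>
  have inv: "ennreal (r powr - s) * (ennreal (r powr s) * c) = c"
    "ennreal (r powr s) * (ennreal (r powr - s) * c) = c" for c
  proof -
    have "ennreal (r powr - s) * ennreal (r powr s) = 1"
      using f by (subst ennreal_mult[symmetric]) (auto simp flip: powr_add)
    then show "ennreal (r powr - s) * (ennreal (r powr s) * c) = c"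
      "ennreal (r powr s) * (ennreal (r powr - s) * c) = c"
      by (metis mult.assoc mult.commute mult_1)+
  qed
  fix \<delta> :: real assume "0 < \<delta>"
  have "ennreal (r powr - s) * hausdorff_premeasure s \<delta> (f ` A) \<le> hausdorff_premeasure s (\<delta> / r) A"
  proof (rule hausdorff_premeasure_ge)
    fix U :: "nat \<Rightarrow> 'a set"
    assume U: "A \<subseteq> (\<Union>i. U i)" "\<And>i. bounded (U i)" "\<And>i. diameter (U i) \<le> \<delta> / r"
    have "hausdorff_premeasure s \<delta> (f ` A) \<le> ennreal (r powr s) * (\<Sum>i. ennreal (diam_powr s (U i)))"
    proof -
      note bd = similarity_bounded_diameter[OF f(1) less_imp_le[OF f(2)]]
      have "diameter (f ` U i) \<le> \<delta>" for i
        using bd(2)[of "U i"] U(2) mult_left_mono[OF U(3)[of i], of r] f(2) by simp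
      then have "hausdorff_premeasure s \<delta> (f ` A) \<le> (\<Sum>i. ennreal (diam_powr s (f ` U i)))"
        using image_mono[OF U(1), of f] U(2) bd(1) by (intro hausdorff_premeasure_le) (simp_all add: image_UN)
      also have "\<dots> \<le> (\<Sum>i. ennreal (r powr s) * ennreal (diam_powr s (U i)))"
      proof (intro suminf_le allI)
        fix i
        have "diameter (f ` U i) powr s \<le> (r * diameter (U i)) powr s"
          using bd(1,2)[of "U i"] U(2) \<open>0 < s\<close> by (intro powr_mono2) (auto intro: diameter_ge_0)
        also have "\<dots> = r powr s * diameter (U i) powr s"
          by (rule powr_mult)
        finally have "diam_powr s (f ` U i) \<le> r powr s * diam_powr s (U i)"
          using \<open>0 < s\<close> by (auto simp: diam_powr_def)
        then show "ennreal (diam_powr s (f ` U i)) \<le> ennreal (r powr s) * ennreal (diam_powr s (U i))"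
          by (subst ennreal_mult[symmetric]) (auto intro: ennreal_leI)
      qed auto
      also have "\<dots> = ennreal (r powr s) * (\<Sum>i. ennreal (diam_powr s (U i)))"
        by simp
      finally show ?thesis .
    qed
    from mult_left_mono[OF this zero_le, of "ennreal (r powr - s)"]
    have "ennreal (r powr - s) * hausdorff_premeasure s \<delta> (f ` A)
        \<le> ennreal (r powr - s) * (ennreal (r powr s) * (\<Sum>i. ennreal (diam_powr s (U i))))" .
    then show "ennreal (r powr - s) * hausdorff_premeasure s \<delta> (f ` A) \<le> (\<Sum>i. ennreal (diam_powr s (U i)))"
      unfolding inv .
  qed
  from mult_left_mono[OF this zero_le, of "ennreal (r powr s)"]
  have "hausdorff_premeasure s \<delta> (f ` A) \<le> ennreal (r powr s) * hausdorff_premeasure s (\<delta> / r) A"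
    unfolding inv .
  also have "\<dots> \<le> ennreal (r powr s) * hausdorff_measure s A"
    using \<open>0 < \<delta>\<close> f by (intro mult_left_mono hausdorff_premeasure_le_measure) auto
  finally show "hausdorff_premeasure s \<delta> (f ` A) \<le> ennreal (r powr s) * hausdorff_measure s A" .
qed

section \<open>Words and invariant sets\<close>

text \<open>After subtracting \<open>f 0\<close>, a similarity is a scaling that fixes the origin,
  hence linear; injective linear maps of a Euclidean space are onto.\<close>

lemma similarity_surj:
  fixes f :: "'a::euclidean_space \<Rightarrow> 'a"
  assumes "similarity_with r f" "0 < r"
  shows "surj f"
proof -
  define h where "h x = f x - f 0" for x
  have h: "\<forall>x y. dist (h x) (h y) = r * dist x y" "h 0 = 0"
    using assms by (auto simp: h_def similarity_with_def dist_norm)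
  then have "linear h" by (intro scaling_linear[of h r]) auto
  moreover have "inj h"
  proof (rule injI)
    fix x y assume "h x = h y"
    then have "r * dist x y = 0" using h by (metis dist_self)
    then show "x = y" using assms by simp
  qed
  ultimately have "surj h" using linear_injective_imp_surjective[of h] by simp
  show ?thesis
  proof (rule surjI)
    fix y
    show "f (SOME x. h x = y - f 0) = y"
      using \<open>surj h\<close> by (rule_tac someI2_ex[of "\<lambda>x. h x = y - f 0"]) (metis surjD, simp add: h_def)
  qed
qed

lemma similarity_image_ball:
  fixes f :: "'a::euclidean_space \<Rightarrow> 'a"
  assumes "similarity_with r f" "0 < r"
  shows "f ` ball x e = ball (f x) (r * e)"
proof (intro equalityI subsetI)
  fix y assume "y \<in> ball (f x) (r * e)"
  moreover obtain z where "y = f z" using similarity_surj[OF assms] by (metis surjD)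
  ultimately show "y \<in> f ` ball x e" using assms by (auto simp: similarity_with_def)
qed (use assms in \<open>auto simp: similarity_with_def\<close>)

lemma similarity_open_image:
  fixes f :: "'a::euclidean_space \<Rightarrow> 'a"
  assumes "similarity_with r f" "0 < r" "open U"
  shows "open (f ` U)"
proof (rule openI)
  fix y assume "y \<in> f ` U"
  then obtain x where "x \<in> U" "y = f x" by blast
  moreover obtain e where "0 < e" "ball x e \<subseteq> U" using assms \<open>x \<in> U\<close> by (meson openE)
  ultimately have "ball y (r * e) \<subseteq> f ` U"
    using similarity_image_ball[OF assms(1,2), of x e] by (metis image_mono)
  then show "\<exists>e>0. ball y e \<subseteq> f ` U"
    using \<open>0 < e\<close> assms(2) by (intro exI[of _ "r * e"]) auto
qed

lemma similarity_continuous: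
  fixes f :: "'a::metric_space \<Rightarrow> 'a"
  assumes "similarity_with r f"
  shows "continuous_on A f"
proof (rule lipschitz_on_continuous_on)
  show "\<bar>r\<bar>-lipschitz_on A f"
    using assms by (auto simp: lipschitz_on_def similarity_with_def intro: mult_right_mono)
qed

text \<open>The first letter is the outermost map, so a prefix of a word describes a larger piece.
  The letters are the maps themselves and not indices, which is faithful because the OSC excludes
  repeated maps.\<close>

definition word_map :: "('a \<Rightarrow> 'a) list \<Rightarrow> 'a \<Rightarrow> 'a" where
  "word_map w = foldr (\<circ>) w id"

definition word_ratio :: "('a::euclidean_space \<Rightarrow> 'a) list \<Rightarrow> real" where
  "word_ratio w = prod_list (map ratio w)"

definition words :: "'b set \<Rightarrow> nat \<Rightarrow> 'b list set" where
  "words \<Phi> n = {w. set w \<subseteq> \<Phi> \<and> length w = n}"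

lemma word_map_simps [simp]:
  "word_map [] = id" "word_map (f # w) = f \<circ> word_map w"
  by (simp_all add: word_map_def)

lemma word_map_append: "word_map (v @ w) = word_map v \<circ> word_map w"
  by (induction v) (auto simp: comp_assoc)

lemma word_ratio_simps [simp]:
  "word_ratio [] = 1" "word_ratio (f # w) = ratio f * word_ratio w"
  by (simp_all add: word_ratio_def)

lemma word_ratio_append: "word_ratio (v @ w) = word_ratio v * word_ratio w"
  by (simp add: word_ratio_def)

lemma wordsD: "w \<in> words \<Phi> n \<Longrightarrow> set w \<subseteq> \<Phi>" "w \<in> words \<Phi> n \<Longrightarrow> length w = n"
  by (auto simp: words_def)

lemma words_0 [simp]: "words \<Phi> 0 = {[]}"
  by (auto simp: words_def)

lemma words_Suc: "words \<Phi> (Suc n) = (\<lambda>(f, w). f # w) ` (\<Phi> \<times> words \<Phi> n)"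
  by (auto simp: words_def length_Suc_conv image_iff)

lemma finite_words: "finite \<Phi> \<Longrightarrow> finite (words \<Phi> n)"
  by (simp add: words_def finite_lists_length_eq)

lemma sum_words:
  assumes "finite \<Phi>"
  shows "(\<Sum>w\<in>words \<Phi> n. word_ratio w powr s) = (\<Sum>f\<in>\<Phi>. ratio f powr s) ^ n"
proof (induction n)
  case (Suc n)
  have "(\<Sum>w\<in>words \<Phi> (Suc n). word_ratio w powr s)
      = (\<Sum>(f, w)\<in>\<Phi> \<times> words \<Phi> n. word_ratio (f # w) powr s)"
    unfolding words_Suc by (subst sum.reindex) (auto simp: inj_on_def intro!: sum.cong)
  also have "\<dots> = (\<Sum>(f, w)\<in>\<Phi> \<times> words \<Phi> n. ratio f powr s * word_ratio w powr s)"
    by (simp add: powr_mult)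
  also have "\<dots> = (\<Sum>f\<in>\<Phi>. ratio f powr s) * (\<Sum>w\<in>words \<Phi> n. word_ratio w powr s)"
    by (simp add: sum_product sum.cartesian_product)
  finally show ?case using Suc by simp
qed simp

locale similarities =
  fixes \<Phi> :: "('a::euclidean_space \<Rightarrow> 'a) set"
  assumes finite_maps: "finite \<Phi>"
    and ratio_pos: "f \<in> \<Phi> \<Longrightarrow> 0 < ratio f"
    and ratio_less_1: "f \<in> \<Phi> \<Longrightarrow> ratio f < 1"
    and similarity: "f \<in> \<Phi> \<Longrightarrow> similarity_with (ratio f) f"
begin

lemma word_ratio_pos: "set w \<subseteq> \<Phi> \<Longrightarrow> 0 < word_ratio w"
  by (induction w) (auto simp: ratio_pos)

lemma word_ratio_le_1: "set w \<subseteq> \<Phi> \<Longrightarrow> word_ratio w \<le> 1"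
  by (induction w) (auto intro!: mult_le_one less_imp_le[OF ratio_less_1] less_imp_le[OF word_ratio_pos])

lemma similarity_word: "set w \<subseteq> \<Phi> \<Longrightarrow> similarity_with (word_ratio w) (word_map w)"
proof (induction w)
  case (Cons f w)
  then show ?case using similarity[of f] by (auto simp: similarity_with_def)
qed (simp add: similarity_with_def)

lemma dist_word: "set w \<subseteq> \<Phi> \<Longrightarrow> dist (word_map w x) (word_map w y) = word_ratio w * dist x y"
  using similarity_word by (auto simp: similarity_with_def)

lemma inj_word: "set w \<subseteq> \<Phi> \<Longrightarrow> inj (word_map w)"
  using dist_word word_ratio_pos by (metis injI dist_eq_0_iff mult_eq_0_iff less_irrefl)

lemma continuous_word: "set w \<subseteq> \<Phi> \<Longrightarrow> continuous_on A (word_map w)"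
  using similarity_word similarity_continuous by blast

lemma word_ratio_small:
  assumes "0 < e"
  obtains N where "\<And>w. set w \<subseteq> \<Phi> \<Longrightarrow> N \<le> length w \<Longrightarrow> word_ratio w < e"
proof -
  \<comment> \<open>Inserting \<open>0\<close> keeps the maximum meaningful for empty
    \<open>\<Phi>\<close>.\<close>
  define c where "c = Max (insert 0 (ratio ` \<Phi>))"
  have c: "0 \<le> c" "c < 1" "\<And>f. f \<in> \<Phi> \<Longrightarrow> ratio f \<le> c"
    using finite_maps ratio_less_1 by (auto simp: c_def)
  have le: "word_ratio w \<le> c ^ length w" if "set w \<subseteq> \<Phi>" for w
    using that c by (induction w) (auto intro!: mult_mono less_imp_le[OF word_ratio_pos])
  obtain N where N: "c ^ N < e" using real_arch_pow_inv[OF assms c(2)] by blast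
  show ?thesis
  proof (rule that)
    fix w assume "set w \<subseteq> \<Phi>" "N \<le> length w"
    then have "word_ratio w \<le> c ^ length w" "c ^ length w \<le> c ^ N"
      using le c by (auto intro: power_decreasing)
    then show "word_ratio w < e" using N by simp
  qed
qed

lemma word_image_subset:
  assumes "\<And>f. f \<in> \<Phi> \<Longrightarrow> f ` K \<subseteq> K" "set w \<subseteq> \<Phi>"
  shows "word_map w ` K \<subseteq> K"
  using assms(2) by (induction w) (use assms(1) in \<open>auto simp: image_subset_iff\<close>)

lemma cover_words:
  assumes "E \<subseteq> (\<Union>f\<in>\<Phi>. f ` E)"
  shows "E \<subseteq> (\<Union>w\<in>words \<Phi> n. word_map w ` E)"
proof (induction n)
  case (Suc n)
  show ?case
  proof
    fix x assume "x \<in> E"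
    then obtain f y where f: "f \<in> \<Phi>" "y \<in> E" "x = f y" using assms by blast
    then obtain w z where w: "w \<in> words \<Phi> n" "z \<in> E" "y = word_map w z" using Suc by blast
    then have "f # w \<in> words \<Phi> (Suc n)" "x = word_map (f # w) z" using f by (auto simp: words_def)
    then show "x \<in> (\<Union>w\<in>words \<Phi> (Suc n). word_map w ` E)" using w by blast
  qed
qed simp

text \<open>A point of \<open>E\<close> lies in an arbitrarily small piece, and the same word sends
  a point of \<open>K\<close> close to it. With only one inclusion required of each set, this yields
  both the uniqueness of the attractor and its position in the closure of \<open>U\<close>.\<close>

lemma subset_invariant:
  assumes E: "bounded E" "E \<subseteq> (\<Union>f\<in>\<Phi>. f ` E)"
    and K: "closed K" "K \<noteq> {}" "\<And>f. f \<in> \<Phi> \<Longrightarrow> f ` K \<subseteq> K"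
  shows "E \<subseteq> K"
proof
  fix x assume "x \<in> E"
  obtain z where z: "z \<in> K" using K by blast
  obtain B where B: "\<And>y. y \<in> E \<Longrightarrow> dist z y \<le> B" "0 < B"
  proof -
    obtain B where "\<forall>y\<in>E. dist z y \<le> B" using E(1) bounded_any_center[of E z] by blast
    then show ?thesis by (intro that[of "max B 1"]) auto
  qed
  have "\<exists>y\<in>K. dist y x < e" if "0 < e" for e
  proof -
    obtain N where N: "\<And>w. set w \<subseteq> \<Phi> \<Longrightarrow> N \<le> length w \<Longrightarrow> word_ratio w < e / B"
      using word_ratio_small[of "e / B"] divide_pos_pos[OF \<open>0 < e\<close> B(2)] by blast
    obtain w y where w: "w \<in> words \<Phi> N" "y \<in> E" "x = word_map w y"
      using cover_words[OF E(2), of N] \<open>x \<in> E\<close> by blast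
    then have "dist (word_map w z) x = word_ratio w * dist z y" by (simp add: dist_word wordsD)
    also have "\<dots> \<le> word_ratio w * B" using w B word_ratio_pos[of w]
      by (intro mult_left_mono) (auto simp: words_def)
    also have "\<dots> < e" using N[of w] w B by (auto simp: words_def pos_less_divide_eq)
    finally show ?thesis using word_image_subset[OF K(3), of w] w z by (auto simp: words_def)
  qed
  then show "x \<in> K" using K(1) closure_approachable[of x K] by (simp add: closure_closed)
qed

text \<open>The iterated images of \<open>K\<close> are nested and compact; their intersection is
  the invariant set.\<close>

lemma invariant_set_exists:
  assumes K: "compact K" "K \<noteq> {}" "\<And>f. f \<in> \<Phi> \<Longrightarrow> f ` K \<subseteq> K" and ne: "\<Phi> \<noteq> {}"
  obtains E where "compact E" "E \<noteq> {}" "E = (\<Union>f\<in>\<Phi>. f ` E)"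
proof -
  define F where "F A = (\<Union>f\<in>\<Phi>. f ` A)" for A
  define L where "L n = (F ^^ n) K" for n
  have F_mono: "F A \<subseteq> F B" if "A \<subseteq> B" for A B using that by (auto simp: F_def)
  have L_Suc: "L (Suc n) = F (L n)" for n by (simp add: L_def)
  have "L (Suc n) \<subseteq> L n" for n
  proof (induction n)
    case 0 then show ?case using K(3) by (auto simp: L_def F_def)
  qed (metis F_mono L_Suc)
  then have anti: "L n \<subseteq> L m" if "m \<le> n" for m n using that by (rule lift_Suc_antimono_le)
  have compact: "compact (L n)" for n
  proof (induction n)
    case (Suc n) then show ?case unfolding L_Suc F_def
      using finite_maps similarity similarity_continuous
      by (intro compact_UN compact_continuous_image) auto
  qed (use K in \<open>simp add: L_def\<close>)
  have "L n \<noteq> {}" for n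
  proof (induction n)
    case (Suc n) then show ?case using ne by (auto simp: L_Suc F_def)
  qed (use K in \<open>simp add: L_def\<close>)
  then have ne': "\<Inter>(range L) \<noteq> {}" by (intro compact_nest compact anti) auto
  have "\<Inter>(range L) = F (\<Inter>(range L))"
  proof (intro equalityI subsetI)
    fix x assume x: "x \<in> \<Inter>(range L)"
    \<comment> \<open>The map that reaches \<open>x\<close> may vary with \<open>n\<close>. By the
      pigeonhole principle one map serves infinitely many levels, hence all of them, and its
      injectivity gives one preimage common to all levels.\<close>
    have "\<exists>f\<in>\<Phi>. x \<in> f ` L n" for n using x L_Suc[of n] unfolding F_def by blast
    then obtain h where h: "\<And>n. h n \<in> \<Phi>" "\<And>n. x \<in> h n ` L n" by metis
    have "finite (range h)" using h(1) finite_maps finite_subset[of "range h" \<Phi>] by blast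
    then obtain f where f: "infinite (h -` {f})"
      using inf_img_fin_domE[of h UNIV] by (metis infinite_UNIV_nat inf_top.right_neutral)
    have in_f: "x \<in> f ` L n" for n
    proof -
      obtain m where "n < m" "h m = f" using f infinite_nat_iff_unbounded[of "h -` {f}"] by auto
      then show ?thesis using h(2)[of m] anti[of n m] by auto
    qed
    have "f \<in> \<Phi>" using infinite_imp_nonempty[OF f] h(1) by auto
    then have "inj f" using inj_word[of "[f]"] by simp
    obtain y where "x = f y" using in_f by blast
    then have "y \<in> L n" for n using in_f[of n] \<open>inj f\<close> by (auto dest: injD)
    then show "x \<in> F (\<Inter>(range L))" using \<open>f \<in> \<Phi>\<close> \<open>x = f y\<close> by (auto simp: F_def)
  next
    fix x assume "x \<in> F (\<Inter>(range L))"
    then have "x \<in> L (Suc n)" for n unfolding L_Suc by (auto simp: F_def)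
    then show "x \<in> \<Inter>(range L)" using anti[of n "Suc n" for n] by (auto dest: subsetD)
  qed
  moreover have "compact (\<Inter>(range L))" using compact by (intro compact_Inter) auto
  ultimately show ?thesis using that[OF _ ne'] by (simp only: F_def)
qed

end

section \<open>Self-similar sets\<close>

text \<open>The counterpart of \<open>osc_set\<close> for a set of maps; the two agree for lists
  without repetitions.\<close>

definition osc_open :: "('a::euclidean_space \<Rightarrow> 'a) set \<Rightarrow> 'a set \<Rightarrow> bool" where
  "osc_open \<Phi> U \<longleftrightarrow> U \<noteq> {} \<and> bounded U \<and> open U \<and> (\<forall>f\<in>\<Phi>. f ` U \<subseteq> U) \<and>
     (\<forall>f\<in>\<Phi>. \<forall>g\<in>\<Phi>. f \<noteq> g \<longrightarrow> f ` U \<inter> g ` U = {})"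

locale self_similar = similarities \<Phi> for \<Phi> :: "('a::euclidean_space \<Rightarrow> 'a) set" +
  fixes E :: "'a set"
  assumes compact_E: "compact E" and ne_E: "E \<noteq> {}" and E_eq: "E = (\<Union>f\<in>\<Phi>. f ` E)"
begin

lemma word_E_subset: "set w \<subseteq> \<Phi> \<Longrightarrow> word_map w ` E \<subseteq> E"
  using E_eq by (intro word_image_subset) blast

lemma E_words: "E = (\<Union>w\<in>words \<Phi> n. word_map w ` E)"
proof
  show "E \<subseteq> (\<Union>w\<in>words \<Phi> n. word_map w ` E)" by (rule cover_words) (use E_eq in auto)
  show "(\<Union>w\<in>words \<Phi> n. word_map w ` E) \<subseteq> E" using word_E_subset wordsD(1) by blast
qed

lemma compact_word_E: "set w \<subseteq> \<Phi> \<Longrightarrow> compact (word_map w ` E)"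
  by (intro compact_continuous_image compact_E continuous_word)

lemma diameter_E_nonneg: "0 \<le> diameter E"
  using compact_E by (simp add: compact_imp_bounded diameter_ge_0)

lemma diameter_word_E: "set w \<subseteq> \<Phi> \<Longrightarrow> diameter (word_map w ` E) \<le> word_ratio w * diameter E"
  using similarity_bounded_diameter(2)[OF similarity_word] word_ratio_pos[of w] compact_E
  by (simp add: compact_imp_bounded less_imp_le)

lemma word_E_small:
  assumes "0 < e"
  obtains N where "\<And>w. set w \<subseteq> \<Phi> \<Longrightarrow> N \<le> length w \<Longrightarrow> diameter (word_map w ` E) < e"
proof -
  have pos: "0 < e / (diameter E + 1)" using assms diameter_E_nonneg by auto
  obtain N where N: "\<And>w. set w \<subseteq> \<Phi> \<Longrightarrow> N \<le> length w \<Longrightarrow> word_ratio w < e / (diameter E + 1)"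
    using word_ratio_small[OF pos] by blast
  show ?thesis
  proof (rule that)
    fix w assume w: "set w \<subseteq> \<Phi>" "N \<le> length w"
    have "diameter (word_map w ` E) \<le> word_ratio w * diameter E" using w by (rule_tac diameter_word_E)
    also have "\<dots> \<le> e / (diameter E + 1) * diameter E"
      using N[OF w] diameter_E_nonneg by (intro mult_right_mono) auto
    also have "\<dots> < e" using assms diameter_E_nonneg by (simp add: field_simps)
    finally show "diameter (word_map w ` E) < e" .
  qed
qed

text \<open>The pieces of a high level form a fine cover whose cost is a power of the Moran sum. A
  sum below \<open>1\<close> gives measure zero, and a sum equal to \<open>1\<close> gives finite
  measure.\<close>

lemma hausdorff_premeasure_upper:
  assumes "0 < t" "0 < \<delta>"
  obtains N where "\<And>n. N \<le> n \<Longrightarrow>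
    hausdorff_premeasure t \<delta> E \<le> ennreal ((\<Sum>f\<in>\<Phi>. ratio f powr t) ^ n * diameter E powr t)"
proof -
  obtain N where N: "\<And>w. set w \<subseteq> \<Phi> \<Longrightarrow> N \<le> length w \<Longrightarrow> diameter (word_map w ` E) < \<delta>"
    using word_E_small[OF \<open>0 < \<delta>\<close>] by blast
  show ?thesis
  proof (rule that)
    fix n assume n: "N \<le> n"
    have "hausdorff_premeasure t \<delta> E = hausdorff_premeasure t \<delta> (\<Union>w\<in>words \<Phi> n. word_map w ` E)"
      using E_words[of n] by simp
    also have "\<dots> \<le> (\<Sum>w\<in>words \<Phi> n. hausdorff_premeasure t \<delta> (word_map w ` E))"
      using assms finite_words[OF finite_maps] by (intro hausdorff_premeasure_UN) auto
    also have "\<dots> \<le> (\<Sum>w\<in>words \<Phi> n. ennreal (word_ratio w powr t * diameter E powr t))"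
    proof (rule sum_mono)
      fix w assume w: "w \<in> words \<Phi> n"
      have bd: "bounded (word_map w ` E)" using compact_word_E w wordsD(1) compact_imp_bounded by blast
      have "hausdorff_premeasure t \<delta> (word_map w ` E) \<le> ennreal (diam_powr t (word_map w ` E))"
        using N[of w] w n assms bd by (intro hausdorff_premeasure_single) (auto simp: words_def)
      also have "diam_powr t (word_map w ` E) = diameter (word_map w ` E) powr t"
        using assms ne_E by (simp add: diam_powr_def)
      also have "\<dots> \<le> (word_ratio w * diameter E) powr t"
        using assms diameter_word_E[of w] w bd by (intro powr_mono2) (auto simp: words_def intro: diameter_ge_0)
      also have "\<dots> = word_ratio w powr t * diameter E powr t" by (rule powr_mult)
      finally show "hausdorff_premeasure t \<delta> (word_map w ` E) \<le> ennreal (word_ratio w powr t * diameter E powr t)"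
        by (simp add: ennreal_leI)
    qed
    also have "\<dots> = ennreal (\<Sum>w\<in>words \<Phi> n. word_ratio w powr t * diameter E powr t)"
      by (rule sum_ennreal) simp
    also have "\<dots> = ennreal ((\<Sum>f\<in>\<Phi>. ratio f powr t) ^ n * diameter E powr t)"
      by (simp add: sum_words[OF finite_maps] flip: sum_distrib_right)
    finally show "hausdorff_premeasure t \<delta> E \<le> ennreal ((\<Sum>f\<in>\<Phi>. ratio f powr t) ^ n * diameter E powr t)" .
  qed
qed

lemma hausdorff_measure_eq_0:
  assumes "0 < t" "(\<Sum>f\<in>\<Phi>. ratio f powr t) < 1"
  shows "hausdorff_measure t E = 0"
proof -
  let ?q = "\<Sum>f\<in>\<Phi>. ratio f powr t"
  have "hausdorff_measure t E \<le> 0"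
  proof (rule hausdorff_measure_le)
    fix \<delta> :: real assume "0 < \<delta>"
    then obtain N where N: "\<And>n. N \<le> n \<Longrightarrow> hausdorff_premeasure t \<delta> E \<le> ennreal (?q ^ n * diameter E powr t)"
      using hausdorff_premeasure_upper[OF assms(1)] by blast
    have "(\<lambda>n. ?q ^ n * diameter E powr t) \<longlonglongrightarrow> 0 * diameter E powr t"
      using assms(2) by (intro tendsto_mult LIMSEQ_realpow_zero tendsto_const sum_nonneg) auto
    then have "(\<lambda>n. ennreal (?q ^ n * diameter E powr t)) \<longlonglongrightarrow> ennreal (0 * diameter E powr t)"
      by (intro tendsto_ennrealI)
    then show "hausdorff_premeasure t \<delta> E \<le> 0"
      using N by (intro LIMSEQ_le_const[of _ _ "hausdorff_premeasure t \<delta> E"]) auto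
  qed
  then show ?thesis by simp
qed

lemma hausdorff_measure_finite:
  assumes "0 < t" "(\<Sum>f\<in>\<Phi>. ratio f powr t) = 1"
  shows "hausdorff_measure t E \<le> ennreal (diameter E powr t)"
proof (rule hausdorff_measure_le)
  fix \<delta> :: real assume "0 < \<delta>"
  then obtain N where N: "\<And>n. N \<le> n \<Longrightarrow> hausdorff_premeasure t \<delta> E \<le>
      ennreal ((\<Sum>f\<in>\<Phi>. ratio f powr t) ^ n * diameter E powr t)"
    using hausdorff_premeasure_upper[OF assms(1)] by blast
  then show "hausdorff_premeasure t \<delta> E \<le> ennreal (diameter E powr t)"
    using assms(2) N[OF order_refl] by simp
qed

text \<open>At the first letter where two words differ, the OSC separates the images; otherwise one
  word is a prefix of the other.\<close>

lemma word_images_meet: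
  assumes U: "osc_open \<Phi> U"
  shows "set u \<subseteq> \<Phi> \<Longrightarrow> set v \<subseteq> \<Phi> \<Longrightarrow> word_map u ` U \<inter> word_map v ` U \<noteq> {} \<Longrightarrow>
    (\<exists>x. v = u @ x) \<or> (\<exists>x. u = v @ x)"
proof (induction u arbitrary: v)
  case (Cons f u)
  show ?case
  proof (cases v)
    case v: (Cons g v')
    have sub: "word_map w ` U \<subseteq> U" if "set w \<subseteq> \<Phi>" for w
      using U that by (intro word_image_subset) (auto simp: osc_open_def)
    have "f ` word_map u ` U \<inter> g ` word_map v' ` U \<noteq> {}"
      using Cons.prems(3) unfolding v by (simp add: image_comp)
    then obtain y z where yz: "y \<in> word_map u ` U" "z \<in> word_map v' ` U" "f y = g z"
      by blast
    have "y \<in> U" "z \<in> U" using sub[of u] sub[of v'] yz Cons.prems v by auto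
    then have "f ` U \<inter> g ` U \<noteq> {}" using yz(3) by blast
    moreover have "f \<in> \<Phi>" "g \<in> \<Phi>" using Cons.prems v by auto
    ultimately have "f = g" using U unfolding osc_open_def by blast
    then have "y = z" using yz(3) inj_word[of "[f]"] Cons.prems(1) by (auto dest: injD)
    then have "(\<exists>x. v' = u @ x) \<or> (\<exists>x. u = v' @ x)"
      using Cons.IH[of v'] Cons.prems v yz by auto
    then show ?thesis using v \<open>f = g\<close> by auto
  qed simp
qed simp

end

lemma sum_UNION_le:
  fixes f :: "'b \<Rightarrow> real"
  assumes "finite A" "\<And>i. i \<in> A \<Longrightarrow> finite (B i)" "\<And>x. 0 \<le> f x"
  shows "sum f (\<Union>i\<in>A. B i) \<le> (\<Sum>i\<in>A. sum f (B i))"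
  using assms(1,2)
proof (induction A)
  case (insert i A)
  have "sum f (\<Union>j\<in>insert i A. B j) \<le> sum f (B i) + sum f (\<Union>j\<in>A. B j)"
    using insert.hyps insert.prems assms(3)
    by (simp add: sum.union_inter[of "B i" "\<Union>j\<in>A. B j" f, symmetric] sum_nonneg)
  then show ?case using insert by simp
qed simp

section \<open>Counting pieces by volume, and the mass distribution over words\<close>

locale self_similar_osc = self_similar \<Phi> E for \<Phi> :: "('a::euclidean_space \<Rightarrow> 'a) set" and E +
  fixes s :: real and U :: "'a set"
  assumes s_pos: "0 < s" and sum_ratio: "(\<Sum>f\<in>\<Phi>. ratio f powr s) = 1" and osc: "osc_open \<Phi> U"
begin

text \<open>Words cut off at scale \<open>\<rho>\<close>: all their ratios are comparable with \<open>\<rho>\<close>, so the volumes of the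
  disjoint images of \<open>U\<close> bound the number of those close to a set of diameter at most \<open>\<rho>\<close>.\<close>

lemma stopping_count:
  obtains M where "\<And>V \<rho>. 0 < \<rho> \<Longrightarrow> bounded V \<Longrightarrow> diameter V \<le> \<rho> \<Longrightarrow>
    finite {u. set u \<subseteq> \<Phi> \<and> u \<noteq> [] \<and> word_ratio u \<le> \<rho> \<and> \<rho> < word_ratio (butlast u) \<and> word_map u ` E \<inter> V \<noteq> {}} \<and>
    real (card {u. set u \<subseteq> \<Phi> \<and> u \<noteq> [] \<and> word_ratio u \<le> \<rho> \<and> \<rho> < word_ratio (butlast u) \<and> word_map u ` E \<inter> V \<noteq> {}}) \<le> M"
proof -
  obtain z where "z \<in> U" using osc by (auto simp: osc_open_def)
  moreover have "open U" using osc by (auto simp: osc_open_def)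
  ultimately obtain a where a: "0 < a" "ball z a \<subseteq> U" by (meson openE)
  obtain R where R: "\<And>e. e \<in> E \<Longrightarrow> dist z e \<le> R"
    using compact_imp_bounded[OF compact_E] bounded_any_center[of E z] by blast
  have "0 \<le> R" using R ne_E by (meson all_not_in_conv order_trans zero_le_dist)
  have ne: "\<Phi> \<noteq> {}" using E_eq ne_E by blast
  define r where "r = Min (ratio ` \<Phi>)"
  have r: "0 < r" "\<And>f. f \<in> \<Phi> \<Longrightarrow> r \<le> ratio f"
    using finite_maps ne ratio_pos by (auto simp: r_def)
  define d where "d = DIM('a)"
  \<comment> \<open>A quotient of volumes: disjoint balls of radius \<open>\<rho> * r * a\<close>
    inside one ball of radius \<open>\<rho> * (1 + R + a + 1)\<close>. The scale
    \<open>\<rho>\<close> cancels.\<close>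
  define M where "M = ((1 + R + a + 1) / (r * a)) ^ d"
  show ?thesis
  proof (rule that[of M])
    fix V :: "'a set" and \<rho> :: real
    assume \<rho>: "0 < \<rho>" and V: "bounded V" "diameter V \<le> \<rho>"
    define T where "T = {u. set u \<subseteq> \<Phi> \<and> u \<noteq> [] \<and> word_ratio u \<le> \<rho> \<and> \<rho> < word_ratio (butlast u) \<and> word_map u ` E \<inter> V \<noteq> {}}"
    have T: "set u \<subseteq> \<Phi>" "u \<noteq> []" "word_ratio u \<le> \<rho>" "\<rho> < word_ratio (butlast u)" "word_map u ` E \<inter> V \<noteq> {}"
      if "u \<in> T" for u using that by (auto simp: T_def)
    obtain N where N: "\<And>w. set w \<subseteq> \<Phi> \<Longrightarrow> N \<le> length w \<Longrightarrow> word_ratio w < \<rho>"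
      using word_ratio_small[OF \<rho>] by blast
    have "length u \<le> N" if "u \<in> T" for u
    proof (rule ccontr)
      assume "\<not> length u \<le> N"
      then have "word_ratio (butlast u) < \<rho>"
        using T(1)[OF that] by (intro N) (auto dest: in_set_butlastD)
      then show False using T(4)[OF that] by simp
    qed
    then have "T \<subseteq> {u. set u \<subseteq> \<Phi> \<and> length u \<le> N}" using T(1) by blast
    then have fin: "finite T" by (rule finite_subset) (rule finite_lists_length_le[OF finite_maps])
    \<comment> \<open>Without its last letter the ratio still exceeds \<open>\<rho>\<close>, and one
      letter costs at most the factor \<open>r\<close>.\<close>
    have lower: "\<rho> * r \<le> word_ratio u" if "u \<in> T" for u
    proof -
      have "word_ratio u = word_ratio (butlast u) * ratio (last u)"
        using word_ratio_append[of "butlast u" "[last u]"] T(2)[OF that] by simp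
      moreover have "last u \<in> \<Phi>" using T(1,2)[OF that] by auto
      moreover have "\<rho> * r \<le> word_ratio (butlast u) * ratio (last u)"
        using T(4)[OF that] \<rho> r(1) r(2)[OF \<open>last u \<in> \<Phi>\<close>] by (intro mult_mono) auto
      ultimately show ?thesis by simp
    qed
    define B where "B u = ball (word_map u z) (\<rho> * r * a)" for u
    have B_sub: "B u \<subseteq> word_map u ` U" if "u \<in> T" for u
    proof -
      have "B u \<subseteq> ball (word_map u z) (word_ratio u * a)"
        using lower[OF that] a unfolding B_def by (intro subset_ball mult_right_mono) auto
      also have "\<dots> = word_map u ` ball z a"
        using similarity_image_ball[OF similarity_word word_ratio_pos] T(1)[OF that] by metis
      also have "\<dots> \<subseteq> word_map u ` U" using a by blast
      finally show ?thesis .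
    qed
    have disj: "B u \<inter> B v = {}" if "u \<in> T" "v \<in> T" "u \<noteq> v" for u v
    proof (rule ccontr)
      \<comment> \<open>No stopping word properly extends another: its ratio without the last letter
        would already be at most that of the shorter word, hence at most
        \<open>\<rho>\<close>.\<close>
      have no: "\<nexists>x. v = u @ x" if uv: "u \<in> T" "v \<in> T" "u \<noteq> v" for u v
      proof
        assume "\<exists>x. v = u @ x"
        then obtain x where x: "v = u @ x" by blast
        with uv have "x \<noteq> []" by auto
        then have "word_ratio (butlast v) = word_ratio u * word_ratio (butlast x)"
          by (simp add: x butlast_append word_ratio_append)
        also have "\<dots> \<le> word_ratio u"
          using T(1)[OF uv(2)] x word_ratio_le_1[of "butlast x"] word_ratio_pos[of u]
          by (intro mult_left_le) (auto dest: in_set_butlastD)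
        finally show False using T(3)[OF uv(1)] T(4)[OF uv(2)] by simp
      qed
      assume "B u \<inter> B v \<noteq> {}"
      then have "word_map u ` U \<inter> word_map v ` U \<noteq> {}"
        using B_sub[OF that(1)] B_sub[OF that(2)] by blast
      then show False
        using word_images_meet[OF osc T(1)[OF that(1)] T(1)[OF that(2)]]
          no[OF that] no[OF that(2,1) that(3)[symmetric]] by blast
    qed
    have "real (card T) \<le> M"
    proof (cases "T = {}")
      case True then show ?thesis using a \<open>0 \<le> R\<close> r by (auto simp: M_def)
    next
      case False
      then obtain p where p: "p \<in> V" using T(5) by blast
      define b where "b = \<rho> * (1 + R + a + 1)"
      have "0 < b" unfolding b_def using \<rho> \<open>0 \<le> R\<close> a by (intro mult_pos_pos) auto
      have "B u \<subseteq> ball p b" if u: "u \<in> T" for u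
      proof
        fix y assume "y \<in> B u"
        then have y: "dist (word_map u z) y < \<rho> * r * a" by (simp add: B_def)
        obtain f where "f \<in> \<Phi>" using ne by blast
        then have "r < 1" using r ratio_less_1 by fastforce
        then have "\<rho> * r * a \<le> \<rho> * a" using \<rho> a by simp
        obtain e where e: "e \<in> E" "word_map u e \<in> V" using T(5)[OF u] by blast
        have "dist p (word_map u e) \<le> \<rho>"
          using diameter_bounded_bound[OF V(1) p e(2)] V(2) by simp
        moreover have "dist (word_map u e) (word_map u z) \<le> \<rho> * R"
          using T(1,3)[OF that] R[OF e(1)] \<rho> by (auto simp: dist_word dist_commute intro!: mult_mono)
        ultimately have "dist p y < \<rho> + \<rho> * R + \<rho> * a"
          using y \<open>\<rho> * r * a \<le> \<rho> * a\<close> dist_triangle[of p y "word_map u e"]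
            dist_triangle[of "word_map u e" y "word_map u z"] by linarith
        also have "\<dots> \<le> b" using \<rho> by (simp add: b_def algebra_simps)
        finally show "y \<in> ball p b" by simp
      qed
      then have "(\<Union>u\<in>T. B u) \<subseteq> ball p b" by blast
      moreover have fm: "ball x e \<in> fmeasurable lborel" for x :: 'a and e
        by (intro fmeasurableI emeasure_bounded_finite) auto
      ultimately have "measure lborel (\<Union>u\<in>T. B u) \<le> measure lborel (ball p b)"
        by (intro measure_mono_fmeasurable fm) (auto simp: B_def intro!: borel_open open_UN)
      moreover have "measure lborel (\<Union>u\<in>T. B u) = (\<Sum>u\<in>T. measure lborel (B u))"
        using fin disj by (intro measure_UNION') (auto simp: B_def[abs_def] fm pairwise_def disjnt_def)
      moreover have "measure lborel (B u) = (\<rho> * r * a) ^ d * unit_ball_vol d" for u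
        unfolding B_def d_def using \<rho> r a by (subst content_ball) (auto simp: mult.commute)
      moreover have "measure lborel (ball p b) = b ^ d * unit_ball_vol d"
        unfolding d_def using \<open>0 < b\<close> by (subst content_ball) (auto simp: mult.commute)
      ultimately have "real (card T) * ((\<rho> * r * a) ^ d * unit_ball_vol d) \<le> b ^ d * unit_ball_vol d" by simp
      then have "real (card T) * (\<rho> * r * a) ^ d \<le> b ^ d"
        using unit_ball_vol_pos[of d] by (simp flip: mult.assoc)
      then have "real (card T) \<le> b ^ d / (\<rho> * r * a) ^ d"
        using \<rho> r a by (simp add: pos_le_divide_eq)
      also have "\<dots> = M" using \<rho> by (simp add: b_def M_def power_divide power_mult_distrib)
      finally show ?thesis .
    qed
    with fin show "finite {u. set u \<subseteq> \<Phi> \<and> u \<noteq> [] \<and> word_ratio u \<le> \<rho> \<and> \<rho> < word_ratio (butlast u) \<and> word_map u ` E \<inter> V \<noteq> {}} \<and>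
    real (card {u. set u \<subseteq> \<Phi> \<and> u \<noteq> [] \<and> word_ratio u \<le> \<rho> \<and> \<rho> < word_ratio (butlast u) \<and> word_map u ` E \<inter> V \<noteq> {}}) \<le> M"
      unfolding T_def by blast
  qed
qed

lemma sum_words_eq_1: "(\<Sum>w\<in>words \<Phi> n. word_ratio w powr s) = 1"
  by (simp add: sum_words[OF finite_maps] sum_ratio)

text \<open>Every long word whose piece meets \<open>V\<close> has a prefix among the boundedly many
  stopping words of scale \<open>\<rho>\<close>. All extensions of such a prefix \<open>u\<close> to
  one level have total mass \<open>word_ratio u powr s\<close>, which is at most
  \<open>\<rho> powr s\<close>.\<close>

lemma word_mass_bound:
  obtains M where "0 < M" "\<And>V \<rho>. 0 < \<rho> \<Longrightarrow> bounded V \<Longrightarrow> diameter V \<le> \<rho> \<Longrightarrow>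
    \<exists>N. \<forall>n\<ge>N. (\<Sum>w | w \<in> words \<Phi> n \<and> word_map w ` E \<inter> V \<noteq> {}. word_ratio w powr s) \<le> M * \<rho> powr s"
proof -
  obtain M0 where M0: "\<And>V \<rho>. 0 < \<rho> \<Longrightarrow> bounded V \<Longrightarrow> diameter V \<le> \<rho> \<Longrightarrow>
    finite {u. set u \<subseteq> \<Phi> \<and> u \<noteq> [] \<and> word_ratio u \<le> \<rho> \<and> \<rho> < word_ratio (butlast u) \<and> word_map u ` E \<inter> V \<noteq> {}} \<and>
    real (card {u. set u \<subseteq> \<Phi> \<and> u \<noteq> [] \<and> word_ratio u \<le> \<rho> \<and> \<rho> < word_ratio (butlast u) \<and> word_map u ` E \<inter> V \<noteq> {}}) \<le> M0"
    using stopping_count by blast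
  define M where "M = max M0 1"
  show ?thesis
  proof (rule that[of M])
    show "0 < M" by (simp add: M_def)
    fix V :: "'a set" and \<rho> :: real
    assume \<rho>: "0 < \<rho>" and V: "bounded V" "diameter V \<le> \<rho>"
    define W where "W n = {w. w \<in> words \<Phi> n \<and> word_map w ` E \<inter> V \<noteq> {}}" for n
    have "\<exists>N. \<forall>n\<ge>N. (\<Sum>w\<in>W n. word_ratio w powr s) \<le> M * \<rho> powr s"
    \<comment> \<open>For \<open>\<rho>\<close> at least \<open>1\<close> the empty word would
      already stop, but it is not a stopping word; there the total mass \<open>1\<close> is a
      sufficient bound.\<close>
    proof (cases "1 \<le> \<rho>")
      case True
      have "(\<Sum>w\<in>W n. word_ratio w powr s) \<le> M * \<rho> powr s" for n
      proof -
        have "(\<Sum>w\<in>W n. word_ratio w powr s) \<le> (\<Sum>w\<in>words \<Phi> n. word_ratio w powr s)"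
          using finite_words[OF finite_maps] by (intro sum_mono2) (auto simp: W_def)
        also have "\<dots> = 1 * 1" by (simp add: sum_words_eq_1)
        also have "\<dots> \<le> M * \<rho> powr s"
          using True s_pos by (intro mult_mono ge_one_powr_ge_zero) (auto simp: M_def)
        finally show ?thesis .
      qed
      then show ?thesis by blast
    next
      case False
      define T where "T = {u. set u \<subseteq> \<Phi> \<and> u \<noteq> [] \<and> word_ratio u \<le> \<rho> \<and> \<rho> < word_ratio (butlast u) \<and> word_map u ` E \<inter> V \<noteq> {}}"
      have T: "finite T" "real (card T) \<le> M0" using M0[OF \<rho> V] unfolding T_def by auto
      obtain N where N: "\<And>w. set w \<subseteq> \<Phi> \<Longrightarrow> N \<le> length w \<Longrightarrow> word_ratio w < \<rho>"
        using word_ratio_small[OF \<rho>] by blast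
      have "(\<Sum>w\<in>W n. word_ratio w powr s) \<le> M * \<rho> powr s" if n: "N \<le> n" for n
      proof -
        have sub: "W n \<subseteq> (\<Union>u\<in>T. (@) u ` words \<Phi> (n - length u))"
        proof
          fix w assume "w \<in> W n"
          then have w: "set w \<subseteq> \<Phi>" "length w = n" "word_map w ` E \<inter> V \<noteq> {}" by (auto simp: W_def words_def)
          \<comment> \<open>Length of the shortest prefix with ratio at most \<open>\<rho>\<close>;
            minimality makes it a stopping word.\<close>
          define k where "k = (LEAST k. word_ratio (take k w) \<le> \<rho>)"
          have "word_ratio (take n w) \<le> \<rho>" using N[of w] w n by simp
          then have k: "word_ratio (take k w) \<le> \<rho>" "k \<le> n"
            unfolding k_def by (auto intro: LeastI Least_le)
          have "k \<noteq> 0" using k(1) False by (intro notI) simp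
          then have "\<not> word_ratio (take (k - 1) w) \<le> \<rho>" unfolding k_def by (intro not_less_Least) simp
          moreover have "butlast (take k w) = take (k - 1) w" using k(2) w by (simp add: butlast_take)
          moreover have "word_map (take k w) ` E \<inter> V \<noteq> {}"
          proof -
            have "word_map w ` E = word_map (take k w) ` word_map (drop k w) ` E"
              by (metis append_take_drop_id image_comp word_map_append)
            moreover have "set (drop k w) \<subseteq> \<Phi>" by (rule order_trans[OF set_drop_subset w(1)])
            ultimately have "word_map w ` E \<subseteq> word_map (take k w) ` E"
              using image_mono[OF word_E_subset[of "drop k w"]] by simp
            then show ?thesis using w(3) by blast
          qed
          moreover have "set (take k w) \<subseteq> \<Phi>" by (rule order_trans[OF set_take_subset w(1)])
          ultimately have "take k w \<in> T" using w k \<open>k \<noteq> 0\<close> by (auto simp: T_def)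
          moreover have "drop k w \<in> words \<Phi> (n - length (take k w))"
            using w k set_drop_subset[of k w] by (auto simp: words_def)
          ultimately show "w \<in> (\<Union>u\<in>T. (@) u ` words \<Phi> (n - length u))"
            by (intro UN_I[of "take k w"] image_eqI[of _ _ "drop k w"]) simp_all
        qed
        have "(\<Sum>w\<in>W n. word_ratio w powr s) \<le> (\<Sum>w\<in>(\<Union>u\<in>T. (@) u ` words \<Phi> (n - length u)). word_ratio w powr s)"
          using sub T(1) finite_words[OF finite_maps] by (intro sum_mono2) auto
        also have "\<dots> \<le> (\<Sum>u\<in>T. \<Sum>w\<in>(@) u ` words \<Phi> (n - length u). word_ratio w powr s)"
          using T(1) finite_words[OF finite_maps] by (intro sum_UNION_le) auto
        also have "\<dots> = (\<Sum>u\<in>T. word_ratio u powr s * (\<Sum>w\<in>words \<Phi> (n - length u). word_ratio w powr s))"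
          by (intro sum.cong refl) (simp add: sum.reindex inj_on_def word_ratio_append powr_mult sum_distrib_left)
        also have "\<dots> = (\<Sum>u\<in>T. word_ratio u powr s)" by (simp add: sum_words_eq_1)
        also have "\<dots> \<le> (\<Sum>u\<in>T. \<rho> powr s)"
          using s_pos word_ratio_pos by (intro sum_mono powr_mono2) (auto simp: T_def less_imp_le)
        also have "\<dots> \<le> M * \<rho> powr s"
          using T(2) by (auto simp: M_def intro!: mult_right_mono)
        finally show ?thesis .
      qed
      then show ?thesis by blast
    qed
    then show "\<exists>N. \<forall>n\<ge>N. (\<Sum>w | w \<in> words \<Phi> n \<and> word_map w ` E \<inter> V \<noteq> {}. word_ratio w powr s) \<le> M * \<rho> powr s"
      unfolding W_def .
  qed
qed

end

section \<open>The natural measure\<close>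

text \<open>Cover sets are fattened to open sets so that compactness applies. Continuity of the
  power, also at \<open>d = 0\<close> because \<open>s\<close> is positive, keeps the cost
  small.\<close>

lemma powr_enlarge:
  fixes d e s :: real
  assumes "0 \<le> d" "0 < e" "0 < s"
  obtains \<eta> where "0 < \<eta>" "(d + 2 * \<eta>) powr s \<le> d powr s + e"
proof -
  have "((\<lambda>\<eta>. (d + 2 * \<eta>) powr s) \<longlongrightarrow> (d + 2 * 0) powr s) (at_right 0)"
    using assms
    by (intro tendsto_powr' tendsto_intros) (auto simp: eventually_at_right_less intro: eventually_mono[OF eventually_at_right_less])
  then have "\<forall>\<^sub>F \<eta> in at_right 0. (d + 2 * \<eta>) powr s < d powr s + e"
    using assms by (intro order_tendstoD) auto
  then have "\<forall>\<^sub>F \<eta> in at_right 0. 0 < \<eta> \<and> (d + 2 * \<eta>) powr s < d powr s + e"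
    using eventually_at_right_less[of "0::real"] by (rule eventually_elim2) auto
  then obtain \<eta> where "0 < \<eta>" "(d + 2 * \<eta>) powr s < d powr s + e"
    using eventually_happens'[of "at_right (0::real)"] by auto
  then show ?thesis by (intro that) auto
qed

lemma neighbourhood_diameter:
  fixes V :: "'a::real_normed_vector set"
  assumes "bounded V" "0 < \<eta>" "V \<noteq> {}"
  shows "bounded (\<Union>x\<in>V. ball x \<eta>)" "diameter (\<Union>x\<in>V. ball x \<eta>) \<le> diameter V + 2 * \<eta>"
proof -
  have le: "dist x y \<le> diameter V + 2 * \<eta>"
    if xy: "x \<in> (\<Union>x\<in>V. ball x \<eta>)" "y \<in> (\<Union>x\<in>V. ball x \<eta>)" for x y
  proof -
    obtain u v where uv: "u \<in> V" "v \<in> V" "dist u x < \<eta>" "dist v y < \<eta>" using xy by auto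
    have "dist u v \<le> diameter V" using diameter_bounded_bound[OF assms(1)] uv by blast
    then show ?thesis using uv dist_triangle[of x y u] dist_triangle[of u y v] dist_commute[of x u]
      by linarith
  qed
  obtain z where "z \<in> V" using assms by blast
  then have "z \<in> (\<Union>x\<in>V. ball x \<eta>)" using assms by (intro UN_I[of z]) auto
  then show "bounded (\<Union>x\<in>V. ball x \<eta>)" using le unfolding bounded_def by blast
  show "diameter (\<Union>x\<in>V. ball x \<eta>) \<le> diameter V + 2 * \<eta>"
    using assms diameter_ge_0[OF assms(1)] le by (intro diameter_le) (auto simp: dist_norm)
qed

context self_similar_osc
begin

text \<open>The mass distribution principle: the words of one level have total mass
  \<open>1\<close>, and each cover set carries at most \<open>M\<close> times the
  \<open>s\<close>-th power of its fattened diameter. Diameters at most \<open>1\<close> make the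
  bound uniform in all exponents \<open>t\<close> up to \<open>s\<close>, which also gives the lower
  bound for the dimension.\<close>

lemma hausdorff_premeasure_lower:
  obtains c where "0 < c" "\<And>t. 0 \<le> t \<Longrightarrow> t \<le> s \<Longrightarrow> ennreal c \<le> hausdorff_premeasure t 1 E"
proof -
  obtain M where M: "0 < M" "\<And>V \<rho>. 0 < \<rho> \<Longrightarrow> bounded V \<Longrightarrow> diameter V \<le> \<rho> \<Longrightarrow>
    \<exists>N. \<forall>n\<ge>N. (\<Sum>w | w \<in> words \<Phi> n \<and> word_map w ` E \<inter> V \<noteq> {}. word_ratio w powr s) \<le> M * \<rho> powr s"
    using word_mass_bound by blast
  \<comment> \<open>The fattening errors below add up to at most \<open>c\<close>, so they use up at
    most half of the total mass; the other half is the asserted bound.\<close>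
  define c where "c = 1 / (2 * M)"
  have "0 < c" using M by (simp add: c_def)
  moreover have "ennreal c \<le> hausdorff_premeasure t 1 E" if t: "0 \<le> t" "t \<le> s" for t
  proof (rule hausdorff_premeasure_ge)
    fix V :: "nat \<Rightarrow> 'a set"
    assume V: "E \<subseteq> (\<Union>i. V i)" "\<And>i. bounded (V i)" "\<And>i. diameter (V i) \<le> 1"
    have nn: "0 \<le> diameter (V i)" for i using V(2) by (rule diameter_ge_0)
    have "\<exists>\<eta>>0. (diameter (V i) + 2 * \<eta>) powr s \<le> diameter (V i) powr s + c * (1 / 2) ^ Suc i" for i
    proof -
      have "0 < c * (1 / 2) ^ Suc i" using \<open>0 < c\<close> by simp
      from powr_enlarge[OF nn[of i] this s_pos] show ?thesis by blast
    qed
    then obtain \<eta> where \<eta>: "\<And>i. 0 < \<eta> i"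
      "\<And>i. (diameter (V i) + 2 * \<eta> i) powr s \<le> diameter (V i) powr s + c * (1 / 2) ^ Suc i" by metis
    define G where "G i = (\<Union>x\<in>V i. ball x (\<eta> i))" for i
    have "V i \<subseteq> G i" for i
      unfolding G_def using \<eta>(1)[of i] by (intro subsetI UN_I) auto
    then have "E \<subseteq> (\<Union>i\<in>UNIV. G i)" using V(1) by (meson SUP_mono order_trans UNIV_I)
    moreover have "open (G i)" for i by (auto simp: G_def)
    ultimately obtain J where J: "finite J" "E \<subseteq> (\<Union>i\<in>J. G i)"
      using compactE_image[OF compact_E, of UNIV G] by metis
    define K where "K = {i\<in>J. V i \<noteq> {}}"
    have "G i = {}" if "V i = {}" for i using that by (simp add: G_def)
    then have "(\<Union>i\<in>J. G i) \<subseteq> (\<Union>i\<in>K. G i)" unfolding K_def by blast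
    with J have K: "finite K" "E \<subseteq> (\<Union>i\<in>K. G i)" by (auto simp: K_def)
    define m where "m n i = (\<Sum>w | w \<in> words \<Phi> n \<and> word_map w ` E \<inter> G i \<noteq> {}. word_ratio w powr s)" for n i
    have "\<forall>i\<in>K. \<exists>N. \<forall>n\<ge>N. m n i \<le> M * (diameter (V i) + 2 * \<eta> i) powr s"
    proof
      fix i assume "i \<in> K"
      then show "\<exists>N. \<forall>n\<ge>N. m n i \<le> M * (diameter (V i) + 2 * \<eta> i) powr s"
        unfolding m_def using neighbourhood_diameter[OF V(2) \<eta>(1), of i] nn[of i] \<eta>(1)[of i]
        by (intro M(2)) (auto simp: G_def K_def)
    qed
    then obtain N where N: "\<forall>i\<in>K. \<forall>n\<ge>N i. m n i \<le> M * (diameter (V i) + 2 * \<eta> i) powr s"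
      by (rule bchoice[THEN exE])
    \<comment> \<open>The level from which the mass bound holds depends on the cover set; the finite
      subcover allows a common one.\<close>
    define n where "n = Max (insert 0 (N ` K))"
    have n: "N i \<le> n" if "i \<in> K" for i using that K(1) by (auto simp: n_def)
    have "words \<Phi> n \<subseteq> (\<Union>i\<in>K. {w. w \<in> words \<Phi> n \<and> word_map w ` E \<inter> G i \<noteq> {}})"
    proof
      fix w assume w: "w \<in> words \<Phi> n"
      obtain x where "x \<in> E" using ne_E by blast
      then have "word_map w x \<in> E" using word_E_subset w wordsD(1) by blast
      then obtain i where i: "i \<in> K" "word_map w x \<in> G i" using subsetD[OF K(2)] by blast
      then have "word_map w ` E \<inter> G i \<noteq> {}" using \<open>x \<in> E\<close> by auto
      then show "w \<in> (\<Union>i\<in>K. {w. w \<in> words \<Phi> n \<and> word_map w ` E \<inter> G i \<noteq> {}})"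
        using i(1) w by auto
    qed
    then have "1 \<le> (\<Sum>w\<in>(\<Union>i\<in>K. {w. w \<in> words \<Phi> n \<and> word_map w ` E \<inter> G i \<noteq> {}}). word_ratio w powr s)"
      unfolding sum_words_eq_1[of n, symmetric]
      using K(1) finite_words[OF finite_maps] by (intro sum_mono2) auto
    also have "\<dots> \<le> (\<Sum>i\<in>K. m n i)"
      unfolding m_def using K(1) finite_words[OF finite_maps] by (intro sum_UNION_le) auto
    also have "\<dots> \<le> (\<Sum>i\<in>K. M * (diameter (V i) + 2 * \<eta> i) powr s)"
      using N n by (intro sum_mono) blast
    also have "\<dots> \<le> (\<Sum>i\<in>K. M * (diam_powr t (V i) + c * (1 / 2) ^ Suc i))"
    proof (intro sum_mono mult_left_mono)
      fix i assume i: "i \<in> K"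
      have "diameter (V i) powr s \<le> diam_powr t (V i)"
        using i V(3)[of i] nn[of i] t s_pos
        by (auto simp: K_def diam_powr_def intro: powr_le1 powr_mono')
      then show "(diameter (V i) + 2 * \<eta> i) powr s \<le> diam_powr t (V i) + c * (1 / 2) ^ Suc i"
        using \<eta>(2)[of i] by linarith
    qed (use M in simp)
    also have "\<dots> = M * ((\<Sum>i\<in>K. diam_powr t (V i)) + c * (\<Sum>i\<in>K. (1 / 2) ^ Suc i))"
      by (simp add: sum_distrib_left sum.distrib distrib_left)
    also have "\<dots> \<le> M * ((\<Sum>i\<in>K. diam_powr t (V i)) + c * 1)"
    proof -
      have "(\<Sum>i\<in>K. (1 / 2 :: real) ^ Suc i) \<le> (\<Sum>i. (1 / 2) ^ Suc i)"
        using K(1) power_half_series by (intro sum_le_suminf) (auto dest: sums_summable)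
      also have "\<dots> = 1" using power_half_series by (rule sums_unique[symmetric])
      finally show ?thesis using M \<open>0 < c\<close> by simp
    qed
    finally have "c \<le> (\<Sum>i\<in>K. diam_powr t (V i))" using M by (simp add: c_def field_simps)
    then have "ennreal c \<le> ennreal (\<Sum>i\<in>K. diam_powr t (V i))" by (rule ennreal_leI)
    also have "\<dots> = (\<Sum>i\<in>K. ennreal (diam_powr t (V i)))" by (rule sum_ennreal[symmetric]) simp
    also have "\<dots> \<le> (\<Sum>i. ennreal (diam_powr t (V i)))" using K(1) by (intro sum_le_suminf) auto
    finally show "ennreal c \<le> (\<Sum>i. ennreal (diam_powr t (V i)))" .
  qed
  ultimately show ?thesis using that by blast
qed

lemma hausdorff_measure_pos:
  assumes "0 \<le> t" "t \<le> s"
  shows "0 < hausdorff_measure t E"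
proof -
  obtain c where c: "0 < c" "ennreal c \<le> hausdorff_premeasure t 1 E"
    using hausdorff_premeasure_lower assms by metis
  then have "0 < ennreal c" by simp
  also have "\<dots> \<le> hausdorff_premeasure t 1 E" by (rule c)
  also have "\<dots> \<le> hausdorff_measure t E" by (rule hausdorff_premeasure_le_measure) simp
  finally show ?thesis .
qed

lemma hausdorff_dim_E: "hausdorff_dim E = s"
proof -
  have ne: "\<Phi> \<noteq> {}" using E_eq ne_E by blast
  have "hausdorff_measure t E = 0" if "s < t" for t
  proof (rule hausdorff_measure_eq_0)
    have "(\<Sum>f\<in>\<Phi>. ratio f powr t) < (\<Sum>f\<in>\<Phi>. ratio f powr s)"
      using that ne finite_maps ratio_pos ratio_less_1 by (intro sum_strict_mono powr_less_mono') auto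
    then show "(\<Sum>f\<in>\<Phi>. ratio f powr t) < 1" by (simp add: sum_ratio)
  qed (use that s_pos in simp)
  then have "{t. 0 \<le> t \<and> hausdorff_measure t E = 0} = {s<..}"
    using s_pos hausdorff_measure_pos by (force simp: not_less)
  then show ?thesis by (simp add: hausdorff_dim_def)
qed

text \<open>This is \<open>natural_measure\<close> with \<open>s\<close> in place of the attractor
  dimension; \<open>hausdorff_dim_E\<close> identifies the two numbers.\<close>

definition \<mu> :: "'a set \<Rightarrow> real" where
  "\<mu> A = enn2real (hausdorff_measure s (A \<inter> E)) / enn2real (hausdorff_measure s E)"

lemma hausdorff_measure_sub_finite: "A \<subseteq> E \<Longrightarrow> hausdorff_measure s A < \<infinity>"
  using order_le_less_trans[OF order_trans[OF hausdorff_measure_mono hausdorff_measure_finite[OF s_pos sum_ratio]]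
    ennreal_less_top] by simp

lemma hausdorff_measure_eq_\<mu>:
  assumes "A \<subseteq> E"
  shows "hausdorff_measure s A = ennreal (\<mu> A) * hausdorff_measure s E"
proof -
  obtain h where h: "hausdorff_measure s E = ennreal h" "0 \<le> h"
    using hausdorff_measure_sub_finite[of E] by (cases "hausdorff_measure s E") auto
  obtain a where a: "hausdorff_measure s A = ennreal a" "0 \<le> a"
    using hausdorff_measure_sub_finite[OF assms] by (cases "hausdorff_measure s A") auto
  have "0 < h" using hausdorff_measure_pos[of s] s_pos h by simp
  then show ?thesis using assms h a by (simp add: \<mu>_def Int_absorb2 flip: ennreal_mult)
qed

lemma \<mu>_nonneg: "0 \<le> \<mu> A" by (simp add: \<mu>_def)

lemma hausdorff_measure_le_iff:
  assumes "A \<subseteq> E" "0 \<le> a"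
  shows "hausdorff_measure s A \<le> ennreal a * hausdorff_measure s E \<longleftrightarrow> \<mu> A \<le> a"
proof -
  obtain h where h: "hausdorff_measure s E = ennreal h" "0 \<le> h"
    using hausdorff_measure_sub_finite[of E] by (cases "hausdorff_measure s E") auto
  have "0 < h" using hausdorff_measure_pos[of s] s_pos h by simp
  then show ?thesis
    using assms h \<mu>_nonneg[of A] hausdorff_measure_eq_\<mu>[OF assms(1)]
    by (simp flip: ennreal_mult)
qed

lemma \<mu>_E: "\<mu> E = 1"
proof -
  have "enn2real (hausdorff_measure s E) \<noteq> 0"
    using hausdorff_measure_pos[of s] s_pos hausdorff_measure_sub_finite[of E]
    by (simp add: enn2real_eq_0_iff less_top zero_less_iff_neq_zero)
  then show ?thesis by (simp add: \<mu>_def)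
qed

lemma \<mu>_mono: "A \<subseteq> B \<Longrightarrow> B \<subseteq> E \<Longrightarrow> \<mu> A \<le> \<mu> B"
  using hausdorff_measure_mono[of A B s] hausdorff_measure_eq_\<mu>[of B] \<mu>_nonneg[of B]
  by (subst hausdorff_measure_le_iff[symmetric]) auto

lemma \<mu>_UN_le:
  assumes "finite K" "\<And>i. i \<in> K \<Longrightarrow> A i \<subseteq> E"
  shows "\<mu> (\<Union>i\<in>K. A i) \<le> (\<Sum>i\<in>K. \<mu> (A i))"
proof -
  have "hausdorff_measure s (\<Union>i\<in>K. A i) \<le> (\<Sum>i\<in>K. hausdorff_measure s (A i))"
    by (rule hausdorff_measure_UN[OF assms(1)])
  also have "\<dots> = (\<Sum>i\<in>K. ennreal (\<mu> (A i)) * hausdorff_measure s E)"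
    using assms(2) by (intro sum.cong refl hausdorff_measure_eq_\<mu>) auto
  also have "\<dots> = ennreal (\<Sum>i\<in>K. \<mu> (A i)) * hausdorff_measure s E"
    by (simp add: \<mu>_nonneg sum_ennreal flip: sum_distrib_right)
  finally show ?thesis
    using assms(2) \<mu>_nonneg by (subst (asm) hausdorff_measure_le_iff) (auto intro: sum_nonneg)
qed

lemma \<mu>_word_le:
  assumes "set w \<subseteq> \<Phi>" "A \<subseteq> E"
  shows "\<mu> (word_map w ` A) \<le> word_ratio w powr s * \<mu> A"
proof -
  have "hausdorff_measure s (word_map w ` A) \<le> ennreal (word_ratio w powr s) * hausdorff_measure s A"
    using similarity_word word_ratio_pos assms s_pos by (intro hausdorff_measure_similarity_le) auto
  also have "\<dots> = ennreal (word_ratio w powr s * \<mu> A) * hausdorff_measure s E"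
    by (simp add: hausdorff_measure_eq_\<mu>[OF assms(2)] \<mu>_nonneg ennreal_mult mult.assoc)
  finally show ?thesis
    using assms word_E_subset[of w] \<mu>_nonneg[of A]
    by (subst (asm) hausdorff_measure_le_iff) auto
qed

lemma \<mu>_Un:
  assumes "compact F" "compact G" "F \<inter> G = {}" "F \<subseteq> E" "G \<subseteq> E"
  shows "\<mu> (F \<union> G) = \<mu> F + \<mu> G"
proof -
  obtain d where d: "0 < d" "\<And>x y. x \<in> F \<Longrightarrow> y \<in> G \<Longrightarrow> d \<le> dist x y"
    using separate_compact_closed[of F G] assms compact_imp_closed by metis
  have "hausdorff_measure s (F \<union> G) = hausdorff_measure s F + hausdorff_measure s G"
    by (rule hausdorff_measure_separated[OF d])
  moreover have "F \<inter> E = F" "G \<inter> E = G" "(F \<union> G) \<inter> E = F \<union> G" using assms by auto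
  ultimately show ?thesis
    using hausdorff_measure_sub_finite[OF assms(4)] hausdorff_measure_sub_finite[OF assms(5)]
    by (simp add: \<mu>_def enn2real_plus add_divide_distrib)
qed

text \<open>Since \<open>\<mu> F + \<mu> (E - F) = 1\<close>, complementary upper bounds that add up to \<open>1\<close> are attained. This
  replaces the measurability of pieces and the null overlaps of different pieces.\<close>

lemma \<mu>_eqI:
  assumes "compact F" "compact (E - F)" "F \<subseteq> E"
    and "\<mu> F \<le> a" "\<mu> (E - F) \<le> b" "a + b = 1"
  shows "\<mu> F = a"
proof -
  have "\<mu> F + \<mu> (E - F) = 1"
    using \<mu>_Un[of F "E - F"] assms \<mu>_E by (simp add: Un_absorb1)
  then show ?thesis using assms by linarith
qed

text \<open>\<open>F\<close> and \<open>E - F\<close> have positive distance, and a piece of smaller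
  diameter cannot meet both.\<close>

lemma clopen_words:
  assumes "compact F" "compact (E - F)" "F \<subseteq> E"
  obtains N where "\<And>n w. N \<le> n \<Longrightarrow> w \<in> words \<Phi> n \<Longrightarrow> word_map w ` E \<subseteq> F \<or> word_map w ` E \<inter> F = {}"
proof -
  obtain d where d: "0 < d" "\<And>x y. x \<in> F \<Longrightarrow> y \<in> E - F \<Longrightarrow> d \<le> dist x y"
    using separate_compact_closed[of F "E - F"] assms compact_imp_closed by blast
  obtain N where N: "\<And>w. set w \<subseteq> \<Phi> \<Longrightarrow> N \<le> length w \<Longrightarrow> diameter (word_map w ` E) < d"
    using word_E_small[OF d(1)] by blast
  show ?thesis
  proof (rule that, rule ccontr)
    fix n w assume n: "N \<le> n" "w \<in> words \<Phi> n"
      and "\<not> (word_map w ` E \<subseteq> F \<or> word_map w ` E \<inter> F = {})"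
    then obtain x y where xy: "x \<in> word_map w ` E" "x \<in> F" "y \<in> word_map w ` E" "y \<notin> F" by blast
    have w: "set w \<subseteq> \<Phi>" "length w = n" using n wordsD by auto
    then have "y \<in> E" using word_E_subset xy by blast
    have "dist x y \<le> diameter (word_map w ` E)"
      using xy compact_word_E[OF w(1)] by (intro diameter_bounded_bound) (auto simp: compact_imp_bounded)
    also have "\<dots> < d" using N w n by simp
    finally show False using d(2)[of x y] xy \<open>y \<in> E\<close> by auto
  qed
qed

lemma \<mu>_word_E_le: "set w \<subseteq> \<Phi> \<Longrightarrow> \<mu> (word_map w ` E) \<le> word_ratio w powr s"
  using \<mu>_word_le[of w E] \<mu>_E by simp

text \<open>The pieces inside \<open>F\<close> and the remaining ones bound \<open>\<mu> F\<close>
  and \<open>\<mu> (E - F)\<close> from above by sums that together give \<open>1\<close>. This is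
  what places the generators of the ideal in the ring.\<close>

lemma \<mu>_clopen_eq_sum:
  assumes F: "compact F" "compact (E - F)" "F \<subseteq> E"
  obtains n where "\<mu> F = (\<Sum>w | w \<in> words \<Phi> n \<and> word_map w ` E \<subseteq> F. word_ratio w powr s)"
proof -
  obtain n where n: "\<And>w. w \<in> words \<Phi> n \<Longrightarrow> word_map w ` E \<subseteq> F \<or> word_map w ` E \<inter> F = {}"
    using clopen_words[OF F] by (metis order_refl)
  define W where "W = {w. w \<in> words \<Phi> n \<and> word_map w ` E \<subseteq> F}"
  have W: "finite W" "W \<subseteq> words \<Phi> n" using finite_words[OF finite_maps] by (auto simp: W_def)
  have F_eq: "F = (\<Union>w\<in>W. word_map w ` E)"
  proof
    show "F \<subseteq> (\<Union>w\<in>W. word_map w ` E)"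
    proof
      fix x assume x: "x \<in> F"
      then obtain w where "w \<in> words \<Phi> n" "x \<in> word_map w ` E" using E_words[of n] F(3) by blast
      then show "x \<in> (\<Union>w\<in>W. word_map w ` E)" using n[of w] x by (auto simp: W_def)
    qed
  qed (auto simp: W_def)
  have sub: "E - F \<subseteq> (\<Union>w\<in>words \<Phi> n - W. word_map w ` E)"
  proof
    fix x assume x: "x \<in> E - F"
    then obtain w where "w \<in> words \<Phi> n" "x \<in> word_map w ` E" using E_words[of n] by blast
    then show "x \<in> (\<Union>w\<in>words \<Phi> n - W. word_map w ` E)" using x by (auto simp: W_def)
  qed
  have *: "\<mu> (\<Union>w\<in>Y. word_map w ` E) \<le> (\<Sum>w\<in>Y. word_ratio w powr s)" if "Y \<subseteq> words \<Phi> n" for Y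
  proof -
    have "\<mu> (\<Union>w\<in>Y. word_map w ` E) \<le> (\<Sum>w\<in>Y. \<mu> (word_map w ` E))"
    proof (rule \<mu>_UN_le)
      show "finite Y" using that finite_words[OF finite_maps] by (rule finite_subset)
      show "word_map w ` E \<subseteq> E" if "w \<in> Y" for w
        using that \<open>Y \<subseteq> words \<Phi> n\<close> by (intro word_E_subset wordsD(1)) blast
    qed
    also have "\<dots> \<le> (\<Sum>w\<in>Y. word_ratio w powr s)"
      using that wordsD(1) by (intro sum_mono \<mu>_word_E_le) blast
    finally show ?thesis .
  qed
  have "\<mu> F = (\<Sum>w\<in>W. word_ratio w powr s)"
  proof (rule \<mu>_eqI[OF F, of _ "\<Sum>w\<in>words \<Phi> n - W. word_ratio w powr s"])
    show "\<mu> F \<le> (\<Sum>w\<in>W. word_ratio w powr s)" using *[OF W(2)] F_eq by simp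
    have "\<mu> (E - F) \<le> \<mu> (\<Union>w\<in>words \<Phi> n - W. word_map w ` E)"
      by (rule \<mu>_mono[OF sub]) (use word_E_subset[OF wordsD(1)] in blast)
    also have "\<dots> \<le> (\<Sum>w\<in>words \<Phi> n - W. word_ratio w powr s)" by (rule *) blast
    finally show "\<mu> (E - F) \<le> (\<Sum>w\<in>words \<Phi> n - W. word_ratio w powr s)" .
    show "(\<Sum>w\<in>W. word_ratio w powr s) + (\<Sum>w\<in>words \<Phi> n - W. word_ratio w powr s) = 1"
      using W finite_words[OF finite_maps] sum_words_eq_1[of n]
      using sum.subset_diff[of W "words \<Phi> n" "\<lambda>w. word_ratio w powr s"] by simp
  qed
  then show ?thesis using that unfolding W_def by blast
qed

text \<open>Since no other piece touches the image of \<open>F\<close>, its complement in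
  \<open>E\<close> consists of the image of \<open>E - F\<close> and the other pieces. It is
  therefore compact, and the two upper bounds add up to \<open>1\<close>.\<close>

lemma \<mu>_word_image:
  assumes F: "compact F" "compact (E - F)" "F \<subseteq> E" and w: "w \<in> words \<Phi> n"
    and disj: "\<And>v. v \<in> words \<Phi> n \<Longrightarrow> v \<noteq> w \<Longrightarrow> word_map w ` F \<inter> word_map v ` E = {}"
  shows "compact (word_map w ` F)" "compact (E - word_map w ` F)"
    and "\<mu> (word_map w ` F) = word_ratio w powr s * \<mu> F"
proof -
  have sw: "set w \<subseteq> \<Phi>" using w wordsD by blast
  show c: "compact (word_map w ` F)" by (intro compact_continuous_image continuous_word sw F)
  define R where "R = (\<Union>v\<in>words \<Phi> n - {w}. word_map v ` E)"
  have eq: "E - word_map w ` F = word_map w ` (E - F) \<union> R"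
  proof -
    have "E = word_map w ` E \<union> R" using E_words[of n] w by (auto simp: R_def)
    moreover have "word_map w ` E - word_map w ` F = word_map w ` (E - F)"
      by (simp add: image_set_diff[OF inj_word[OF sw]])
    moreover have "R \<inter> word_map w ` F = {}" using disj by (auto simp: R_def)
    ultimately show ?thesis by blast
  qed
  have "compact R" unfolding R_def
    using finite_words[OF finite_maps] compact_word_E wordsD(1) by (intro compact_UN) blast+
  moreover have "compact (word_map w ` (E - F))" by (intro compact_continuous_image continuous_word sw F)
  ultimately show c': "compact (E - word_map w ` F)" unfolding eq by (intro compact_Un)
  have RE: "R \<subseteq> E" "word_map w ` (E - F) \<subseteq> E"
    unfolding R_def using word_E_subset[OF wordsD(1)] word_E_subset[OF sw] by blast+
  show "\<mu> (word_map w ` F) = word_ratio w powr s * \<mu> F"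
  proof (rule \<mu>_eqI[OF c c', of _ "word_ratio w powr s * \<mu> (E - F) + (\<Sum>v\<in>words \<Phi> n - {w}. word_ratio v powr s)"])
    show "word_map w ` F \<subseteq> E" using word_E_subset[OF sw] F(3) by blast
    show "\<mu> (word_map w ` F) \<le> word_ratio w powr s * \<mu> F" by (rule \<mu>_word_le[OF sw F(3)])
    have "\<mu> (E - word_map w ` F) \<le> \<mu> (word_map w ` (E - F)) + \<mu> R"
      unfolding eq using \<mu>_UN_le[of "{True, False}" "\<lambda>b. if b then word_map w ` (E - F) else R"] RE
      by (simp add: Un_commute)
    also have "\<dots> \<le> word_ratio w powr s * \<mu> (E - F) + (\<Sum>v\<in>words \<Phi> n - {w}. word_ratio v powr s)"
    proof (intro add_mono \<mu>_word_le[OF sw])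
      have "\<mu> R \<le> (\<Sum>v\<in>words \<Phi> n - {w}. \<mu> (word_map v ` E))"
        unfolding R_def using finite_words[OF finite_maps] by (intro \<mu>_UN_le word_E_subset wordsD(1)) auto
      also have "\<dots> \<le> (\<Sum>v\<in>words \<Phi> n - {w}. word_ratio v powr s)"
        using wordsD(1) by (intro sum_mono \<mu>_word_E_le) blast
      finally show "\<mu> R \<le> (\<Sum>v\<in>words \<Phi> n - {w}. word_ratio v powr s)" .
    qed simp
    finally show "\<mu> (E - word_map w ` F) \<le> \<dots>" .
    have "\<mu> F + \<mu> (E - F) = 1" using \<mu>_Un[of F "E - F"] F \<mu>_E by (simp add: Un_absorb1)
    moreover have "word_ratio w powr s + (\<Sum>v\<in>words \<Phi> n - {w}. word_ratio v powr s) = 1"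
      using sum.remove[OF finite_words[OF finite_maps] w, of "\<lambda>v. word_ratio v powr s"] sum_words_eq_1[of n] by simp
    ultimately show "word_ratio w powr s * \<mu> F + (word_ratio w powr s * \<mu> (E - F)
        + (\<Sum>v\<in>words \<Phi> n - {w}. word_ratio v powr s)) = 1"
      by (simp add: add.assoc[symmetric] distrib_left[symmetric])
  qed
qed

end

section \<open>An open set that meets the attractor\<close>

lemma orthogonal_transformation_funpow:
  fixes T :: "'a::real_inner \<Rightarrow> 'a"
  shows "orthogonal_transformation T \<Longrightarrow> orthogonal_transformation (T ^^ n)"
proof (induction n)
  case 0
  then show ?case by (simp add: id_def)
next
  case (Suc n)
  then show ?case unfolding funpow.simps by (intro orthogonal_transformation_compose) auto
qed

text \<open>The powers of \<open>T\<close> are bounded in a finite-dimensional space of operators,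
  so a subsequence is Cauchy. For two close powers, the isometry \<open>T ^^ r M\<close> cancels and
  leaves the power given by the difference of exponents.\<close>

lemma orthogonal_transformation_recurrent:
  fixes T :: "'a::euclidean_space \<Rightarrow> 'a"
  assumes T: "orthogonal_transformation T" and "0 < e"
  obtains L where "L0 \<le> L" "\<And>h. norm ((T ^^ L) h - h) \<le> e * norm h"
proof -
  have orth: "orthogonal_transformation (T ^^ n)" for n
    using T by (rule orthogonal_transformation_funpow)
  have norm_T: "norm ((T ^^ n) h) = norm h" for n h using orth orthogonal_transformation_norm by blast
  have lin: "linear (T ^^ n)" for n using orth orthogonal_transformation_linear by blast
  define P where "P n = Blinfun (T ^^ n)" for n
  have P: "blinfun_apply (P n) h = (T ^^ n) h" for n h
    unfolding P_def using lin by (subst bounded_linear_Blinfun_apply) (auto simp: linear_conv_bounded_linear)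
  have "norm (P n) \<le> 1" for n by (rule norm_blinfun_bound) (simp_all add: P norm_T)
  then have "bounded (range P)" by (auto simp: bounded_iff)
  then obtain l r where r: "strict_mono (r :: nat \<Rightarrow> nat)" "(P \<circ> r) \<longlonglongrightarrow> l"
    using bounded_imp_convergent_subsequence by blast
  then have "Cauchy (P \<circ> r)" by (intro LIMSEQ_imp_Cauchy)
  then obtain M where M: "\<And>m n. M \<le> m \<Longrightarrow> M \<le> n \<Longrightarrow> norm (P (r m) - P (r n)) < e"
    using CauchyD[OF _ \<open>0 < e\<close>] by (metis comp_apply)
  \<comment> \<open>The exponents can be taken far apart, which makes \<open>L\<close> at least
    \<open>L0\<close>.\<close>
  have grow: "r M + k \<le> r (M + k)" for k
  proof (induction k)
    case (Suc k) then show ?case using strict_monoD[OF r(1), of "M + k" "M + Suc k"] by simp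
  qed simp
  define L where "L = r (M + L0) - r M"
  have L: "r (M + L0) = r M + L" "L0 \<le> L" using grow[of L0] by (auto simp: L_def)
  show ?thesis
  proof (rule that[OF L(2)])
    fix h
    have "norm ((T ^^ L) h - h) = norm ((T ^^ r M) ((T ^^ L) h - h))" by (simp add: norm_T)
    also have "(T ^^ r M) ((T ^^ L) h - h) = (P (r (M + L0)) - P (r M)) h"
      using L(1) by (simp add: linear_diff[OF lin] P minus_blinfun.rep_eq funpow_add)
    also have "norm \<dots> \<le> norm (P (r (M + L0)) - P (r M)) * norm h" by (rule norm_blinfun)
    also have "\<dots> \<le> e * norm h" using M[of "M + L0" M] by (intro mult_right_mono) auto
    finally show "norm ((T ^^ L) h - h) \<le> e * norm h" .
  qed
qed

text \<open>The map \<open>T\<close> is the adjoint of the common linear part of all maps, up to the ratios.\<close>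

locale homogeneous_ifs = self_similar \<Phi> E for \<Phi> :: "('a::euclidean_space \<Rightarrow> 'a) set" and E +
  fixes T :: "'a \<Rightarrow> 'a" and U :: "'a set"
  assumes orth_T: "orthogonal_transformation T"
    and inner_map: "f \<in> \<Phi> \<Longrightarrow> g \<bullet> (f x - f y) = ratio f * (T g \<bullet> (x - y))"
    and osc_U: "osc_open \<Phi> U" and convex_U: "convex U"
begin

lemma orth_Tn: "orthogonal_transformation (T ^^ n)"
  using orth_T by (rule orthogonal_transformation_funpow)

lemma norm_Tn [simp]: "norm ((T ^^ n) h) = norm h"
  using orth_Tn orthogonal_transformation_norm by blast

text \<open>The direction on the right depends on \<open>w\<close> only through its length. This is
  where homogeneity enters the argument.\<close>

lemma inner_word:
  "set w \<subseteq> \<Phi> \<Longrightarrow> g \<bullet> (word_map w x - word_map w y) = word_ratio w * ((T ^^ length w) g \<bullet> (x - y))"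
proof (induction w arbitrary: g)
  case (Cons f w)
  then have "g \<bullet> (word_map (f # w) x - word_map (f # w) y)
      = ratio f * (T g \<bullet> (word_map w x - word_map w y))"
    using inner_map[of f] by simp
  also have "\<dots> = word_ratio (f # w) * ((T ^^ length w) (T g) \<bullet> (x - y))" using Cons by simp
  finally show ?case by (simp add: funpow_swap1)
qed simp

lemma convex_word_image:
  assumes "set w \<subseteq> \<Phi>" "convex K"
  shows "convex (word_map w ` K)"
proof -
  have affine: "word_map w (u *\<^sub>R x + v *\<^sub>R y) = u *\<^sub>R word_map w x + v *\<^sub>R word_map w y"
    if "u + v = 1" for u v x y
  proof -
    have v: "v = 1 - u" using that by simp
    have "g \<bullet> (word_map w (u *\<^sub>R x + v *\<^sub>R y) - word_map w y) = g \<bullet> (u *\<^sub>R (word_map w x - word_map w y))" for g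
    proof -
      have eq: "u *\<^sub>R x + v *\<^sub>R y - y = u *\<^sub>R (x - y)" by (simp add: v algebra_simps)
      show ?thesis
        unfolding inner_scaleR_right inner_word[OF assms(1)] eq by simp
    qed
    then have "word_map w (u *\<^sub>R x + v *\<^sub>R y) - word_map w y = u *\<^sub>R (word_map w x - word_map w y)"
      using vector_eq_ldot by blast
    then show ?thesis by (simp add: v algebra_simps)
  qed
  show ?thesis
  proof (rule convexI)
    fix a b u v assume "a \<in> word_map w ` K" "b \<in> word_map w ` K" "0 \<le> u" "0 \<le> v" "u + v = (1::real)"
    then obtain x y where "x \<in> K" "y \<in> K" "a = word_map w x" "b = word_map w y" by blast
    then show "u *\<^sub>R a + v *\<^sub>R b \<in> word_map w ` K"
      using affine[OF \<open>u + v = 1\<close>] convexD[OF assms(2) \<open>x \<in> K\<close> \<open>y \<in> K\<close>] \<open>0 \<le> u\<close> \<open>0 \<le> v\<close> \<open>u + v = 1\<close>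
      by (metis imageI)
  qed
qed

lemma E_subset_closure: "E \<subseteq> closure U"
proof (rule subset_invariant)
  show "bounded E" using compact_E by (rule compact_imp_bounded)
  show "E \<subseteq> (\<Union>f\<in>\<Phi>. f ` E)" using E_eq by blast
  show "closure U \<noteq> {}" using osc_U by (simp add: osc_open_def)
  fix f assume f: "f \<in> \<Phi>"
  show "f ` closure U \<subseteq> closure U"
  proof (rule image_closure_subset)
    show "continuous_on (closure U) f" using similarity[OF f] by (rule similarity_continuous)
    show "f ` U \<subseteq> closure U" using f osc_U closure_subset by (fastforce simp: osc_open_def)
  qed simp
qed simp

text \<open>Distinct words of equal length are not prefixes of each other, so the images of
  \<open>U\<close> are disjoint convex sets. The weak inequalities pass to the closure, which
  contains \<open>E\<close>.\<close>

lemma separate_words: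
  assumes "w \<in> words \<Phi> n" "v \<in> words \<Phi> n" "w \<noteq> v"
  obtains g c where "g \<noteq> 0" "\<And>z. z \<in> closure U \<Longrightarrow> g \<bullet> word_map w z \<le> c"
    "\<And>z. z \<in> closure U \<Longrightarrow> c \<le> g \<bullet> word_map v z"
proof -
  have w: "set w \<subseteq> \<Phi>" "set v \<subseteq> \<Phi>" "length w = length v" using assms by (auto simp: words_def)
  have "word_map w ` U \<inter> word_map v ` U = {}"
    using word_images_meet[OF osc_U w(1,2)] assms(3) w(3) by fastforce
  moreover have "U \<noteq> {}" using osc_U by (simp add: osc_open_def)
  ultimately obtain g c where gc: "g \<noteq> 0" "\<forall>x\<in>word_map w ` U. g \<bullet> x \<le> c" "\<forall>x\<in>word_map v ` U. c \<le> g \<bullet> x"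
    using separating_hyperplane_sets[OF convex_word_image[OF w(1) convex_U] convex_word_image[OF w(2) convex_U]]
    by auto
  show ?thesis
  proof (rule that[OF gc(1)])
    fix z assume z: "z \<in> closure U"
    show "g \<bullet> word_map w z \<le> c"
      using z by (rule continuous_le_on_closure[rotated])
        (use gc(2) in \<open>auto intro!: continuous_intros continuous_word w\<close>)
    show "c \<le> g \<bullet> word_map v z"
      using z by (rule continuous_ge_on_closure[rotated])
        (use gc(3) in \<open>auto intro!: continuous_intros continuous_word w\<close>)
  qed
qed

lemma constant_on_U_imp_0:
  assumes "\<And>z. z \<in> U \<Longrightarrow> h \<bullet> z = c"
  shows "h = 0"
proof (rule ccontr)
  assume "h \<noteq> 0"
  obtain z where z: "z \<in> U" using osc_U by (auto simp: osc_open_def)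
  then obtain e where e: "0 < e" "ball z e \<subseteq> U" using osc_U by (meson openE osc_open_def)
  define y where "y = z + (e / 2 / norm h) *\<^sub>R h"
  have "dist z y = e / 2" using \<open>h \<noteq> 0\<close> e by (simp add: y_def dist_norm)
  then have "y \<in> U" using e by auto
  then have "h \<bullet> y = h \<bullet> z" using assms z by simp
  then show False using \<open>h \<noteq> 0\<close> e by (simp add: y_def inner_add_right)
qed

text \<open>The functionals constant on \<open>E\<close>. The complement
  \<open>Z\<^sup>\<bottom>\<close> is the direction space of the affine hull of \<open>E\<close>, so
  working there amounts to working in the relative topology of that hull.\<close>

definition Z :: "'a set" where "Z = {h. \<forall>x\<in>E. \<forall>y\<in>E. h \<bullet> (x - y) = 0}"

lemma subspace_Z: "subspace Z"
  by (auto simp: Z_def subspace_def inner_add_left)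

text \<open>Any map of the system sends \<open>E\<close> into \<open>E\<close>, which gives one
  inclusion; the dimensions agree because \<open>T\<close> is injective. Equality is what lets
  \<open>T\<close> preserve \<open>Z\<^sup>\<bottom>\<close> as well.\<close>

lemma T_image_Z: "T ` Z = Z"
proof -
  have "T ` Z \<subseteq> Z"
  proof
    fix k assume "k \<in> T ` Z"
    then obtain h where h: "h \<in> Z" "k = T h" by blast
    obtain f where f: "f \<in> \<Phi>" using E_eq ne_E by blast
    have "T h \<bullet> (x - y) = 0" if "x \<in> E" "y \<in> E" for x y
    proof -
      have "f x \<in> E" "f y \<in> E" using that f E_eq by blast+
      then have "ratio f * (T h \<bullet> (x - y)) = 0" using h(1) inner_map[OF f, of h x y] by (simp add: Z_def)
      then show ?thesis using ratio_pos[OF f] by simp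
    qed
    then show "k \<in> Z" using h by (simp add: Z_def)
  qed
  moreover have lin: "linear T" using orth_T by (rule orthogonal_transformation_linear)
  moreover have "dim (T ` Z) = dim Z"
    using lin orthogonal_transformation_inj[OF orth_T] by (intro dim_image_eq) (auto intro: inj_on_subset)
  ultimately show ?thesis
    using subspace_Z by (intro subspace_dim_equal linear_subspace_image) auto
qed

lemma T_comp_Z: "h \<in> Z\<^sup>\<bottom> \<Longrightarrow> T h \<in> Z\<^sup>\<bottom>"
proof -
  assume h: "h \<in> Z\<^sup>\<bottom>"
  have "k \<bullet> T h = 0" if "k \<in> Z" for k
  proof -
    obtain k' where "k' \<in> Z" "k = T k'" using T_image_Z \<open>k \<in> Z\<close> by blast
    then show ?thesis using orth_T h by (simp add: orthogonal_transformation_def orthogonal_comp_def orthogonal_def)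
  qed
  then show ?thesis by (simp add: orthogonal_comp_def orthogonal_def)
qed

lemma Tn_comp_Z: "h \<in> Z\<^sup>\<bottom> \<Longrightarrow> (T ^^ n) h \<in> Z\<^sup>\<bottom>"
  by (induction n) (auto intro: T_comp_Z)

text \<open>A separating functional that is constant on \<open>E\<close> would bound \<open>U\<close> from both sides by the same
  value, because all maps have the same linear part; so its component along \<open>E\<close> does not vanish.\<close>

lemma separate_along_E:
  assumes "f \<in> \<Phi>" "f' \<in> \<Phi>" "f \<noteq> f'"
  obtains g c where "g \<in> Z\<^sup>\<bottom>" "norm g = 1" "\<And>x. x \<in> E \<Longrightarrow> g \<bullet> f x \<le> c" "\<And>x. x \<in> E \<Longrightarrow> c \<le> g \<bullet> f' x"
proof -
  have fE: "f x \<in> E" "f' x \<in> E" if "x \<in> E" for x using assms that E_eq by blast+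
  have "[f] \<in> words \<Phi> 1" "[f'] \<in> words \<Phi> 1" "[f] \<noteq> [f']" using assms by (auto simp: words_def)
  then obtain g0 c0 where g0: "g0 \<noteq> 0" "\<And>z. z \<in> closure U \<Longrightarrow> g0 \<bullet> f z \<le> c0"
      "\<And>z. z \<in> closure U \<Longrightarrow> c0 \<le> g0 \<bullet> f' z"
    by (rule separate_words) auto
  \<comment> \<open>The part \<open>k\<close> is constant on \<open>E\<close> and is absorbed into
    the bound \<open>c0\<close>.\<close>
  obtain k g where kg: "k \<in> Z" "g \<in> Z\<^sup>\<bottom>" "g0 = k + g"
    using subspace_sum_orthogonal_comp[OF subspace_Z] by (metis UNIV_I set_plus_elim)
  obtain e where e: "e \<in> E" using ne_E by blast
  have k: "k \<bullet> x = k \<bullet> e" if "x \<in> E" for x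
  proof -
    have "k \<bullet> (x - e) = 0" using kg(1) that e unfolding Z_def by blast
    then show ?thesis by (simp add: inner_diff_right)
  qed
  have g: "g \<bullet> f x \<le> c0 - k \<bullet> e" "c0 - k \<bullet> e \<le> g \<bullet> f' x" if x: "x \<in> E" for x
  proof -
    have "x \<in> closure U" using x E_subset_closure by blast
    then have "k \<bullet> f x + g \<bullet> f x \<le> c0" "c0 \<le> k \<bullet> f' x + g \<bullet> f' x"
      using g0(2,3)[of x] unfolding kg(3) inner_add_left by blast+
    then show "g \<bullet> f x \<le> c0 - k \<bullet> e" "c0 - k \<bullet> e \<le> g \<bullet> f' x"
      using k[OF fE(1)[OF x]] k[OF fE(2)[OF x]] by auto
  qed
  have "g \<noteq> 0"
  proof
    assume "g = 0"
    then have c0: "c0 = k \<bullet> e" using g[OF e] by simp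
    have "T g0 \<bullet> z = T g0 \<bullet> e" if z: "z \<in> U" for z
    proof -
      have z': "z \<in> closure U" using z closure_subset by blast
      have "g0 \<bullet> f z \<le> g0 \<bullet> f e" "g0 \<bullet> f' e \<le> g0 \<bullet> f' z"
        using g0(2,3)[OF z'] c0 k[OF fE(1)[OF e]] k[OF fE(2)[OF e]] \<open>g = 0\<close> kg(3) by auto
      then have "ratio f * (T g0 \<bullet> (z - e)) \<le> 0" "0 \<le> ratio f' * (T g0 \<bullet> (z - e))"
        using inner_map[OF assms(1), of g0 z e] inner_map[OF assms(2), of g0 z e]
        by (simp_all add: inner_diff_right)
      then have "T g0 \<bullet> (z - e) \<le> 0" "0 \<le> T g0 \<bullet> (z - e)"
        using ratio_pos[OF assms(1)] ratio_pos[OF assms(2)] by (auto simp: mult_le_0_iff zero_le_mult_iff)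
      then show ?thesis by (simp add: inner_diff_right)
    qed
    then have "T g0 = 0" by (rule constant_on_U_imp_0)
    then show False using g0(1) norm_Tn[of 1 g0] by simp
  qed
  show ?thesis
  proof (rule that[of "g /\<^sub>R norm g" "(c0 - k \<bullet> e) / norm g"])
    show "g /\<^sub>R norm g \<in> Z\<^sup>\<bottom>" using kg(2) subspace_orthogonal_comp by (intro subspace_scale) auto
    show "norm (g /\<^sub>R norm g) = 1" using \<open>g \<noteq> 0\<close> by simp
  qed (use g \<open>g \<noteq> 0\<close> in \<open>auto simp: divide_simps mult.commute\<close>)
qed

text \<open>No unit vector of \<open>Z\<^sup>\<bottom>\<close> is constant on \<open>E\<close>, and
  compactness of the unit sphere there leaves finitely many witnessing pairs. They form a list
  because the next construction recurses over them.\<close>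

lemma width_bound:
  obtains js \<eta> where "set js \<subseteq> E \<times> E" "0 < \<eta>"
    "\<And>h. h \<in> Z\<^sup>\<bottom> \<Longrightarrow> norm h = 1 \<Longrightarrow> \<exists>(u, v)\<in>set js. \<eta> \<le> h \<bullet> (u - v)"
proof -
  define K where "K = Z\<^sup>\<bottom> \<inter> sphere 0 1"
  have "compact K" unfolding K_def
    by (intro closed_Int_compact closed_subspace subspace_orthogonal_comp compact_sphere)
  define C where "C = (\<lambda>(u, v, \<eta>). {h :: 'a. \<eta> < h \<bullet> (u - v)})"
  define I where "I = {(u, v, \<eta>). u \<in> E \<and> v \<in> E \<and> (0::real) < \<eta>}"
  have "K \<subseteq> (\<Union>i\<in>I. C i)"
  proof
    fix h assume h: "h \<in> K"
    have "h \<notin> Z"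
    proof
      assume "h \<in> Z"
      then have "h \<bullet> h = 0" using h by (auto simp: K_def orthogonal_comp_def orthogonal_def)
      then show False using h by (auto simp: K_def)
    qed
    then obtain x y where xy: "x \<in> E" "y \<in> E" "h \<bullet> (x - y) \<noteq> 0" by (auto simp: Z_def)
    then obtain u v where uv: "u \<in> E" "v \<in> E" "0 < h \<bullet> (u - v)"
      by (cases "0 < h \<bullet> (x - y)") (auto simp: inner_diff_right)
    then have "(u, v, h \<bullet> (u - v) / 2) \<in> I" "h \<in> C (u, v, h \<bullet> (u - v) / 2)" by (auto simp: I_def C_def)
    then show "h \<in> (\<Union>i\<in>I. C i)" by blast
  qed
  moreover have "open (C i)" for i
    by (cases i) (auto simp: C_def intro!: open_Collect_less continuous_intros)
  ultimately obtain J where J: "J \<subseteq> I" "finite J" "K \<subseteq> (\<Union>i\<in>J. C i)"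
    using compactE_image[OF \<open>compact K\<close>, of I C] by metis
  define \<eta> where "\<eta> = Min (insert 1 ((snd \<circ> snd) ` J))"
  have \<eta>: "0 < \<eta>" "\<And>i. i \<in> J \<Longrightarrow> \<eta> \<le> snd (snd i)"
    using J(1,2) by (auto simp: \<eta>_def I_def)
  have "finite ((\<lambda>(u, v, _). (u, v)) ` J)" using J(2) by (rule finite_imageI)
  from finite_list[OF this] obtain js where js: "set js = (\<lambda>(u, v, _). (u, v)) ` J" ..
  show ?thesis
  proof (rule that[of js \<eta>])
    show "set js \<subseteq> E \<times> E" unfolding js using J(1) by (auto simp: I_def split: prod.splits)
    show "0 < \<eta>" by (rule \<eta>)
    fix h assume "h \<in> Z\<^sup>\<bottom>" "norm h = 1"
    then have "h \<in> K" by (simp add: K_def)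
    then obtain i where i: "i \<in> J" "h \<in> C i" using subsetD[OF J(3)] by blast
    obtain u v t where t: "i = (u, v, t)" by (rule prod_cases3)
    have "\<eta> \<le> h \<bullet> (u - v)" using i(2) \<eta>(2)[OF i(1)] by (simp add: t C_def)
    moreover have "(u, v) \<in> set js" unfolding js using i(1) t by (intro image_eqI[of _ _ i]) auto
    ultimately show "\<exists>(u, v)\<in>set js. \<eta> \<le> h \<bullet> (u - v)" by blast
  qed
qed

text \<open>Concatenating words whose pieces approximate the points \<open>v\<close>: for each pair \<open>(u, v)\<close> the
  corresponding prefix moves a point away from the supporting hyperplanes in directions \<open>h\<close> with
  \<open>h \<bullet> (u - v)\<close> large. The recurrence of \<open>T\<close> keeps the directions nearly unchanged along the word.\<close>

lemma deep_word:
  fixes L :: nat and \<epsilon> B \<eta> :: real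
  assumes L: "\<And>h. norm ((T ^^ L) h - h) \<le> \<epsilon> * norm h" "0 \<le> \<epsilon>"
    and B: "\<And>x y. x \<in> E \<Longrightarrow> y \<in> E \<Longrightarrow> norm (x - y) \<le> B"
    and small: "\<And>w. w \<in> words \<Phi> L \<Longrightarrow> diameter (word_map w ` E) \<le> \<eta>" and "0 < \<eta>"
  shows "set js \<subseteq> E \<times> E \<Longrightarrow> \<exists>w. set w \<subseteq> \<Phi> \<and> (\<forall>e\<in>E. \<forall>h. norm h = 1 \<longrightarrow>
    (\<exists>(u, v)\<in>set js. 2 * \<eta> + length js * (\<epsilon> * B) \<le> h \<bullet> (u - v)) \<longrightarrow>
    (\<exists>x\<in>E. h \<bullet> word_map w e + word_ratio w * \<eta> \<le> h \<bullet> x))"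
proof (induction js)
  case Nil
  show ?case by (rule exI[of _ "[]"]) simp
next
  case (Cons p js)
  obtain u v where p: "p = (u, v)" "u \<in> E" "v \<in> E" using Cons.prems by (cases p) auto
  have "0 \<le> \<epsilon> * B" using L(2) B[OF p(2,2)] by simp
  obtain w where w: "set w \<subseteq> \<Phi>" and IH: "\<And>e h. e \<in> E \<Longrightarrow> norm h = 1 \<Longrightarrow>
    (\<exists>(u, v)\<in>set js. 2 * \<eta> + length js * (\<epsilon> * B) \<le> h \<bullet> (u - v)) \<Longrightarrow>
    (\<exists>x\<in>E. h \<bullet> word_map w e + word_ratio w * \<eta> \<le> h \<bullet> x)"
    using Cons by fastforce
  obtain a where a: "a \<in> words \<Phi> L" "v \<in> word_map a ` E" using E_words[of L] p(3) by blast
  note sa = wordsD(1)[OF a(1)]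
  show ?case
  proof (intro exI[of _ "a @ w"] conjI ballI allI impI)
    show "set (a @ w) \<subseteq> \<Phi>" using sa w by auto
    fix e h assume e: "e \<in> E" and h: "norm h = 1"
      and "\<exists>(u, v)\<in>set (p # js). 2 * \<eta> + length (p # js) * (\<epsilon> * B) \<le> h \<bullet> (u - v)"
    then consider "2 * \<eta> + length (p # js) * (\<epsilon> * B) \<le> h \<bullet> (u - v)"
      | u' v' where "(u', v') \<in> set js" "2 * \<eta> + length (p # js) * (\<epsilon> * B) \<le> h \<bullet> (u' - v')"
      using p(1) by auto
    then show "\<exists>x\<in>E. h \<bullet> word_map (a @ w) e + word_ratio (a @ w) * \<eta> \<le> h \<bullet> x"
    proof cases
      case 1
      \<comment> \<open>The front block \<open>a\<close> puts the point into a piece of diameter at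
        most \<open>\<eta>\<close> that contains \<open>v\<close>, so it stays at least
        \<open>\<eta>\<close> below \<open>u\<close>.\<close>
      define y where "y = word_map (a @ w) e"
      have "word_map w e \<in> E" using word_E_subset[OF w] e by blast
      then have "y \<in> word_map a ` E" by (simp add: y_def word_map_append)
      then have "dist v y \<le> \<eta>"
        using diameter_bounded_bound[of "word_map a ` E" v y] compact_word_E[OF sa] a(2) small[OF a(1)]
        by (simp add: compact_imp_bounded)
      then have "\<bar>h \<bullet> (v - y)\<bar> \<le> \<eta>" using Cauchy_Schwarz_ineq2[of h "v - y"] h by (simp add: dist_norm)
      moreover have "0 \<le> length (p # js) * (\<epsilon> * B)" using \<open>0 \<le> \<epsilon> * B\<close> by simp
      then have "2 * \<eta> \<le> h \<bullet> (u - v)" using 1 by linarith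
      moreover have "word_ratio (a @ w) * \<eta> \<le> \<eta>"
        using word_ratio_le_1[of "a @ w"] sa w \<open>0 < \<eta>\<close> by simp
      ultimately have "h \<bullet> y + word_ratio (a @ w) * \<eta> \<le> h \<bullet> u" by (simp add: inner_diff_right)
      then show ?thesis using p(2) unfolding y_def by blast
    next
      case 2
      \<comment> \<open>Seen through the block \<open>a\<close>, the direction \<open>h\<close>
        becomes \<open>h'\<close>. The drift costs at most \<open>\<epsilon> * B\<close>, which is
        the tolerance reserved for one list entry, and the gain shrinks by
        \<open>word_ratio a\<close>.\<close>
      define h' where "h' = (T ^^ L) h"
      have uv: "u' \<in> E" "v' \<in> E" using 2(1) Cons.prems by auto
      have "\<bar>(h' - h) \<bullet> (u' - v')\<bar> \<le> norm (h' - h) * norm (u' - v')" by (rule Cauchy_Schwarz_ineq2)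
      also have "\<dots> \<le> \<epsilon> * B"
        using L(1)[of h] L(2) h B[OF uv] by (intro mult_mono) (auto simp: h'_def)
      finally have "2 * \<eta> + length js * (\<epsilon> * B) \<le> h' \<bullet> (u' - v')"
        using 2(2) by (simp add: inner_diff_left distrib_right)
      moreover have "norm h' = 1" using h by (simp add: h'_def)
      ultimately obtain x where x: "x \<in> E" "h' \<bullet> word_map w e + word_ratio w * \<eta> \<le> h' \<bullet> x"
        using IH[OF e, of h'] 2(1) by blast
      have "word_ratio a * (word_ratio w * \<eta>) \<le> word_ratio a * (h' \<bullet> (x - word_map w e))"
        using x(2) word_ratio_pos[OF sa] by (intro mult_left_mono) (auto simp: inner_diff_right)
      also have "\<dots> = h \<bullet> (word_map a x - word_map a (word_map w e))"
        using inner_word[OF sa] wordsD(2)[OF a(1)] by (simp add: h'_def)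
      finally have "h \<bullet> word_map (a @ w) e + word_ratio (a @ w) * \<eta> \<le> h \<bullet> word_map a x"
        by (simp add: word_map_append word_ratio_append inner_diff_right mult.assoc)
      then show ?thesis using word_E_subset[OF sa] x(1) by blast
    qed
  qed
qed

text \<open>Such a point lies in the relative interior of the convex hull of \<open>E\<close>, at a
  depth \<open>\<delta>\<close> uniform over all directions along \<open>E\<close>.\<close>

lemma deep_point:
  obtains y \<delta> where "y \<in> E" "0 < \<delta>"
    "\<And>h. h \<in> Z\<^sup>\<bottom> \<Longrightarrow> norm h = 1 \<Longrightarrow> \<exists>x\<in>E. h \<bullet> y + \<delta> \<le> h \<bullet> x"
proof -
  obtain js \<eta>0 where js: "set js \<subseteq> E \<times> E" "0 < \<eta>0"
    "\<And>h. h \<in> Z\<^sup>\<bottom> \<Longrightarrow> norm h = 1 \<Longrightarrow> \<exists>(u, v)\<in>set js. \<eta>0 \<le> h \<bullet> (u - v)"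
    using width_bound by metis
  \<comment> \<open>Two thirds of the width \<open>\<eta>0\<close> supply the
    \<open>2 * \<eta>\<close> in \<open>deep_word\<close>; the last third pays for the rotational
    drift, which the choice of \<open>\<epsilon>\<close> below limits to
    \<open>\<eta>\<close>.\<close>
  define \<eta> where "\<eta> = \<eta>0 / 3"
  have "0 < \<eta>" using js by (simp add: \<eta>_def)
  define B where "B = diameter E"
  have B: "norm (x - y) \<le> B" if "x \<in> E" "y \<in> E" for x y
    using diameter_bounded_bound[OF compact_imp_bounded[OF compact_E] that] by (simp add: B_def dist_norm)
  have "0 \<le> B" using diameter_E_nonneg by (simp add: B_def)
  define \<epsilon> where "\<epsilon> = \<eta> / (length js * B + 1)"
  have pos: "0 < length js * B + 1" using \<open>0 \<le> B\<close> by (simp add: add_nonneg_pos)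
  then have "0 < \<epsilon>" using \<open>0 < \<eta>\<close> by (simp add: \<epsilon>_def)
  have "length js * (\<epsilon> * B) = \<eta> * ((length js * B) / (length js * B + 1))" by (simp add: \<epsilon>_def)
  also have "\<dots> \<le> \<eta> * 1" using pos \<open>0 < \<eta>\<close> by (intro mult_left_mono) auto
  finally have le: "2 * \<eta> + length js * (\<epsilon> * B) \<le> \<eta>0" by (simp add: \<eta>_def)
  obtain L0 where L0: "\<And>w. set w \<subseteq> \<Phi> \<Longrightarrow> L0 \<le> length w \<Longrightarrow> diameter (word_map w ` E) < \<eta>"
    using word_E_small[OF \<open>0 < \<eta>\<close>] by blast
  obtain L where L: "L0 \<le> L" "\<And>h. norm ((T ^^ L) h - h) \<le> \<epsilon> * norm h"
    using orthogonal_transformation_recurrent[OF orth_T \<open>0 < \<epsilon>\<close>] by blast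
  have "\<exists>w. set w \<subseteq> \<Phi> \<and> (\<forall>e\<in>E. \<forall>h. norm h = 1 \<longrightarrow>
    (\<exists>(u, v)\<in>set js. 2 * \<eta> + length js * (\<epsilon> * B) \<le> h \<bullet> (u - v)) \<longrightarrow>
    (\<exists>x\<in>E. h \<bullet> word_map w e + word_ratio w * \<eta> \<le> h \<bullet> x))"
  proof (rule deep_word[OF L(2) less_imp_le[OF \<open>0 < \<epsilon>\<close>] B _ \<open>0 < \<eta>\<close> js(1)])
    fix w assume "w \<in> words \<Phi> L"
    then show "diameter (word_map w ` E) \<le> \<eta>" using L0[of w] L(1) by (simp add: words_def less_imp_le)
  qed
  then obtain w where w: "set w \<subseteq> \<Phi>" "\<And>e h. e \<in> E \<Longrightarrow> norm h = 1 \<Longrightarrow>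
    (\<exists>(u, v)\<in>set js. 2 * \<eta> + length js * (\<epsilon> * B) \<le> h \<bullet> (u - v)) \<Longrightarrow>
    (\<exists>x\<in>E. h \<bullet> word_map w e + word_ratio w * \<eta> \<le> h \<bullet> x)" by blast
  obtain e where e: "e \<in> E" using ne_E by blast
  show ?thesis
  proof (rule that[of "word_map w e" "word_ratio w * \<eta>"])
    show "word_map w e \<in> E" using word_E_subset[OF w(1)] e by blast
    show "0 < word_ratio w * \<eta>" using word_ratio_pos[OF w(1)] \<open>0 < \<eta>\<close> by simp
    fix h assume h: "h \<in> Z\<^sup>\<bottom>" "norm h = 1"
    then obtain u v where "(u, v) \<in> set js" "\<eta>0 \<le> h \<bullet> (u - v)" using js(3) by blast
    then have "\<exists>(u, v)\<in>set js. 2 * \<eta> + length js * (\<epsilon> * B) \<le> h \<bullet> (u - v)" using le by force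
    then show "\<exists>x\<in>E. h \<bullet> word_map w e + word_ratio w * \<eta> \<le> h \<bullet> x" using w(2)[OF e h(2)] by blast
  qed
qed

text \<open>Collecting the images of a ball under all words makes \<open>Q\<close> forward invariant
  by construction. Disjointness of first-level images follows because every image of the ball stays
  strictly on the side of the hyperplane on which its piece of \<open>E\<close> lies.\<close>

lemma strong_osc:
  obtains Q y where "osc_open \<Phi> Q" "y \<in> E" "y \<in> Q"
proof -
  obtain y \<delta> where y: "y \<in> E" "0 < \<delta>"
    "\<And>h. h \<in> Z\<^sup>\<bottom> \<Longrightarrow> norm h = 1 \<Longrightarrow> \<exists>x\<in>E. h \<bullet> y + \<delta> \<le> h \<bullet> x"
    using deep_point by metis
  define Q where "Q = (\<Union>w\<in>{w. set w \<subseteq> \<Phi>}. word_map w ` ball y \<delta>)"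
  have "y \<in> word_map [] ` ball y \<delta>" using y by simp
  then have "y \<in> Q" unfolding Q_def by (rule UN_I[rotated]) simp
  \<comment> \<open>In the transported direction, \<open>z\<close> deviates from \<open>y\<close> by
    less than the depth \<open>\<delta>\<close>, so some point \<open>x\<close> of \<open>E\<close>
    is further out. Its image obeys the bound \<open>c\<close>, and the image of \<open>z\<close> is
    strictly lower.\<close>
  have below: "g \<bullet> f (word_map w z) < c"
    if f: "f \<in> \<Phi>" and w: "set w \<subseteq> \<Phi>" and z: "z \<in> ball y \<delta>"
      and g: "g \<in> Z\<^sup>\<bottom>" "norm g = 1" "\<And>x. x \<in> E \<Longrightarrow> g \<bullet> f x \<le> c" for g c f w z
  proof -
    define h where "h = (T ^^ length (f # w)) g"
    have fw: "set (f # w) \<subseteq> \<Phi>" using f w by simp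
    have "h \<in> Z\<^sup>\<bottom>" "norm h = 1" using Tn_comp_Z g by (simp_all add: h_def del: funpow.simps)
    then obtain x where x: "x \<in> E" "h \<bullet> y + \<delta> \<le> h \<bullet> x" using y(3) by blast
    have "\<bar>h \<bullet> (z - y)\<bar> \<le> norm (z - y)" using Cauchy_Schwarz_ineq2[of h "z - y"] \<open>norm h = 1\<close> by simp
    also have "\<dots> < \<delta>" using z by (simp add: dist_norm norm_minus_commute)
    finally have "h \<bullet> (z - x) < 0" using x(2) by (simp add: inner_diff_right)
    then have "word_ratio (f # w) * (h \<bullet> (z - x)) < 0"
      using word_ratio_pos[OF fw] by (simp only: mult_less_0_iff) simp
    then have "g \<bullet> (word_map (f # w) z - word_map (f # w) x) < 0"
      using inner_word[OF fw, of g z x] by (simp only: h_def)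
    moreover have "word_map w x \<in> E" using word_E_subset[OF w] x(1) by blast
    ultimately show ?thesis using g(3) by (fastforce simp: inner_diff_right)
  qed
  have "osc_open \<Phi> Q"
    unfolding osc_open_def
  proof (intro conjI ballI impI)
    show "Q \<noteq> {}" using \<open>y \<in> Q\<close> by blast
    have "Q \<subseteq> ball y (diameter E + \<delta>)"
    proof
      fix x assume "x \<in> Q"
      then obtain w z where w: "set w \<subseteq> \<Phi>" and z: "z \<in> ball y \<delta>" and x: "x = word_map w z" by (auto simp: Q_def)
      have "dist (word_map w y) x \<le> 1 * dist y z"
        unfolding x dist_word[OF w] by (intro mult_right_mono word_ratio_le_1 w) simp
      moreover have "dist y (word_map w y) \<le> diameter E"
        using y(1) word_E_subset[OF w] compact_E by (intro diameter_bounded_bound) (auto simp: compact_imp_bounded)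
      ultimately show "x \<in> ball y (diameter E + \<delta>)" using z dist_triangle[of y x "word_map w y"] by simp
    qed
    then show "bounded Q" using bounded_ball bounded_subset by blast
    show "open Q" unfolding Q_def
      using similarity_open_image[OF similarity_word word_ratio_pos] by (intro open_UN) auto
    show "f ` Q \<subseteq> Q" if "f \<in> \<Phi>" for f
    proof
      fix x assume "x \<in> f ` Q"
      then obtain w z where "set w \<subseteq> \<Phi>" "z \<in> ball y \<delta>" "x = word_map (f # w) z" by (auto simp: Q_def)
      moreover have "set (f # w) \<subseteq> \<Phi>" using \<open>set w \<subseteq> \<Phi>\<close> that by simp
      ultimately show "x \<in> Q" unfolding Q_def by blast
    qed
    show "f ` Q \<inter> f' ` Q = {}" if f: "f \<in> \<Phi>" "f' \<in> \<Phi>" "f \<noteq> f'" for f f'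
    proof (rule ccontr)
      assume "f ` Q \<inter> f' ` Q \<noteq> {}"
      then obtain a b where ab: "a \<in> Q" "b \<in> Q" "f a = f' b" by blast
      obtain w z where w: "set w \<subseteq> \<Phi>" "z \<in> ball y \<delta>" "a = word_map w z" using ab by (auto simp: Q_def)
      obtain w' z' where w': "set w' \<subseteq> \<Phi>" "z' \<in> ball y \<delta>" "b = word_map w' z'" using ab by (auto simp: Q_def)
      obtain g c where g: "g \<in> Z\<^sup>\<bottom>" "norm g = 1" "\<And>x. x \<in> E \<Longrightarrow> g \<bullet> f x \<le> c" "\<And>x. x \<in> E \<Longrightarrow> c \<le> g \<bullet> f' x"
        using separate_along_E[OF f] by metis
      have "g \<bullet> f a < c" using below[OF f(1) w(1,2) g(1-3)] w(3) by simp
      moreover have "- g \<in> Z\<^sup>\<bottom>" using g(1) subspace_neg[OF subspace_orthogonal_comp] by blast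
      then have "(- g) \<bullet> f' b < - c"
        using below[OF f(2) w'(1,2), of "- g" "- c"] g w'(3) by simp
      ultimately show False using ab(3) by simp
    qed
  qed
  then show ?thesis using that y(1) \<open>y \<in> Q\<close> by blast
qed

end

section \<open>Interior separated pieces\<close>

text \<open>In a totally disconnected set the component of \<open>x\<close> is a single point, and
  in a compact set components have arbitrarily small clopen neighbourhoods (Sura-Bura).\<close>

lemma clopen_neighbourhood:
  fixes E :: "'a::euclidean_space set"
  assumes "compact E" "totally_disconnected E" "x \<in> E" "open V" "x \<in> V"
  obtains C where "x \<in> C" "C \<subseteq> E" "C \<subseteq> V" "compact C" "compact (E - C)"
proof -
  have "connected_component_set E x \<subseteq> E" "connected (connected_component_set E x)" "x \<in> connected_component_set E x"
    using assms(3) by (auto simp: connected_component_subset connected_connected_component)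
  then have "connected_component_set E x = {x}"
    using assms(2) unfolding totally_disconnected_def by blast
  then have "{x} \<in> components E" using assms(3) by (metis componentsI)
  moreover have "locally compact E" using assms(1) by (simp add: closed_imp_locally_compact compact_imp_closed)
  ultimately obtain K where K: "openin (top_of_set E) K" "compact K" "{x} \<subseteq> K" "K \<subseteq> V"
    using Sura_Bura_clopen_subset[of E "{x}" V] assms(4,5) by auto
  obtain W where W: "open W" "K = E \<inter> W" using K(1) by (auto simp: openin_open)
  have "compact (E - W)" using assms(1) W(1) by (rule compact_diff)
  moreover have "E - K = E - W" using W by blast
  ultimately show ?thesis using K W by (intro that[of K]) auto
qed

locale homogeneous_ifs_measure = homogeneous_ifs \<Phi> E T U + self_similar_osc \<Phi> E s U
  for \<Phi> :: "('a::euclidean_space \<Rightarrow> 'a) set" and E T U s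
begin

text \<open>The normal cone of \<open>U\<close> at \<open>x\<close>, transported by \<open>T\<close>, orders the points \<open>word_map v x\<close>. If
  \<open>word_map v x\<close> lies on another piece \<open>v'\<close>, the separating functional of the two pieces is a normal
  vector along which \<open>word_map v' x\<close> is strictly further out. Hence a maximal \<open>v\<close> is free.\<close>

lemma exists_free_word:
  assumes x: "x \<in> E" and W: "W \<subseteq> words \<Phi> n" "W \<noteq> {}"
    and closed: "\<And>v v'. v \<in> W \<Longrightarrow> v' \<in> words \<Phi> n \<Longrightarrow> word_map v ` E \<inter> word_map v' ` E \<noteq> {} \<Longrightarrow> v' \<in> W"
  shows "\<exists>v\<in>W. \<forall>v'\<in>words \<Phi> n. v' \<noteq> v \<longrightarrow> word_map v x \<notin> word_map v' ` E"
proof -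
  define N where "N = {g. \<forall>z\<in>closure U. (T ^^ n) g \<bullet> (z - x) \<le> 0}"
  \<comment> \<open>The strict part of the preorder given by the cone \<open>N\<close>; the
    separating functional will supply the one direction of strict increase.\<close>
  define less where "less v v' \<longleftrightarrow> (\<forall>g\<in>N. g \<bullet> word_map v x \<le> g \<bullet> word_map v' x) \<and>
    (\<exists>g\<in>N. g \<bullet> word_map v x < g \<bullet> word_map v' x)" for v v'
  have "finite W" using W(1) finite_words[OF finite_maps] by (rule finite_subset)
  moreover have "asymp_on W less" by (intro asymp_onI) (force simp: less_def)
  moreover have "transp_on W less"
  proof (intro transp_onI)
    fix a b c assume ab: "less a b" and bc: "less b c"
    then obtain g where "g \<in> N" "g \<bullet> word_map a x < g \<bullet> word_map b x" by (auto simp: less_def)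
    moreover have "\<forall>g\<in>N. g \<bullet> word_map a x \<le> g \<bullet> word_map b x" "\<forall>g\<in>N. g \<bullet> word_map b x \<le> g \<bullet> word_map c x"
      using ab bc by (auto simp: less_def)
    ultimately show "less a c" unfolding less_def by (meson order_trans order_less_le_trans)
  qed
  ultimately obtain v where v: "v \<in> W" "\<And>v'. v' \<in> W \<Longrightarrow> v' \<noteq> v \<Longrightarrow> \<not> less v v'"
    using Finite_Set.bex_max_element[of W less] W(2) by blast
  have "word_map v x \<notin> word_map v' ` E" if v': "v' \<in> words \<Phi> n" "v' \<noteq> v" for v'
  proof
    assume "word_map v x \<in> word_map v' ` E"
    then obtain x' where x': "x' \<in> E" "word_map v x = word_map v' x'" by blast
    then have "v' \<in> W" using closed[OF v(1) v'(1)] x by blast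
    have xU: "x \<in> closure U" "x' \<in> closure U" using x x'(1) E_subset_closure by auto
    have vw: "v \<in> words \<Phi> n" using v(1) W(1) by blast
    note pos = word_ratio_pos[OF wordsD(1)[OF vw]] word_ratio_pos[OF wordsD(1)[OF v'(1)]]
    have inner: "g \<bullet> word_map u a - g \<bullet> word_map u b = word_ratio u * ((T ^^ n) g \<bullet> (a - b))"
      if "u \<in> words \<Phi> n" for u g a b
      using inner_word[OF wordsD(1)[OF that], of g a b] wordsD(2)[OF that] by (simp add: inner_diff_right)
    obtain g c where g: "g \<noteq> 0" "\<And>z. z \<in> closure U \<Longrightarrow> g \<bullet> word_map v z \<le> c"
      "\<And>z. z \<in> closure U \<Longrightarrow> c \<le> g \<bullet> word_map v' z"
      using separate_words[OF vw v'(1)] v'(2) by metis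
    \<comment> \<open>The common point of the two pieces lies on the separating hyperplane, so
      \<open>x\<close> maximizes the transported functional over the closure of
      \<open>U\<close>.\<close>
    have c: "g \<bullet> word_map v x = c" using g(2)[OF xU(1)] g(3)[OF xU(2)] x'(2) by simp
    have "g \<in> N" unfolding N_def
    proof (intro CollectI ballI)
      fix z assume "z \<in> closure U"
      then have "word_ratio v * ((T ^^ n) g \<bullet> (z - x)) \<le> 0"
        using g(2)[of z] c inner[OF vw, of g z x] by simp
      then show "(T ^^ n) g \<bullet> (z - x) \<le> 0" using pos(1) by (simp add: mult_le_0_iff)
    qed
    have "g \<bullet> word_map v x < g \<bullet> word_map v' x"
    proof (rule ccontr)
      assume "\<not> ?thesis"
      then have le: "g \<bullet> word_map v' x \<le> c" using c by simp
      \<comment> \<open>Without strict increase, \<open>x\<close> would also minimize the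
        transported functional, which would then be constant on the open set
        \<open>U\<close>.\<close>
      have "(T ^^ n) g \<bullet> z = (T ^^ n) g \<bullet> x" if "z \<in> U" for z
      proof -
        have z: "z \<in> closure U" using that closure_subset by blast
        then have "0 \<le> word_ratio v' * ((T ^^ n) g \<bullet> (z - x))"
          using le g(3)[OF z] inner[OF v'(1), of g z x] by simp
        then have "0 \<le> (T ^^ n) g \<bullet> (z - x)" using pos(2) by (simp add: zero_le_mult_iff)
        moreover have "(T ^^ n) g \<bullet> (z - x) \<le> 0" using \<open>g \<in> N\<close> z by (simp add: N_def)
        ultimately show ?thesis by (simp add: inner_diff_right)
      qed
      then have "(T ^^ n) g = 0" by (rule constant_on_U_imp_0)
      then show False using g(1) norm_Tn[of n g] by simp
    qed
    \<comment> \<open>For the other normals: \<open>x'\<close> is no further out than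
      \<open>x\<close>, and \<open>word_map v'\<close> preserves this order, while it sends
      \<open>x'\<close> to the common point.\<close>
    moreover have "h \<bullet> word_map v x \<le> h \<bullet> word_map v' x" if "h \<in> N" for h
    proof -
      have "(T ^^ n) h \<bullet> (x' - x) \<le> 0" using that xU(2) by (simp add: N_def)
      then have "h \<bullet> word_map v' x' - h \<bullet> word_map v' x \<le> 0"
        using pos(2) unfolding inner[OF v'(1)] by (simp add: mult_le_0_iff)
      then show ?thesis using x'(2) by simp
    qed
    ultimately have "less v v'" using \<open>g \<in> N\<close> unfolding less_def by blast
    then show False using v(2)[OF \<open>v' \<in> W\<close> v'(2)] by blast
  qed
  then show ?thesis using v(1) by blast
qed

text \<open>The ideal enters through three closure properties: zero, sums, and cancellation of the
  factors \<open>word_ratio w powr s\<close>. Free words make every small clopen set around any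
  point of \<open>E\<close> contribute its measure to \<open>I\<close>.\<close>

lemma one_in_ideal:
  fixes I :: "real set"
  assumes td: "totally_disconnected E"
    and zero: "0 \<in> I" and add: "\<And>a b. a \<in> I \<Longrightarrow> b \<in> I \<Longrightarrow> a + b \<in> I"
    and unit: "\<And>w a. set w \<subseteq> \<Phi> \<Longrightarrow> word_ratio w powr s * a \<in> I \<Longrightarrow> a \<in> I"
    and gen: "\<And>F Q. compact F \<Longrightarrow> compact (E - F) \<Longrightarrow> F \<subseteq> E \<Longrightarrow> osc_open \<Phi> Q \<Longrightarrow> F \<subseteq> Q \<Longrightarrow> \<mu> F \<in> I"
  shows "1 \<in> I"
proof -
  obtain Q y where Q: "osc_open \<Phi> Q" "y \<in> E" "y \<in> Q" using strong_osc by metis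
  then have "open Q" by (simp add: osc_open_def)
  then obtain C where C: "y \<in> C" "C \<subseteq> E" "C \<subseteq> Q" "compact C" "compact (E - C)"
    using clopen_neighbourhood[OF compact_E td Q(2)] Q(3) by metis
  obtain n where n: "\<And>w. w \<in> words \<Phi> n \<Longrightarrow> word_map w ` E \<subseteq> C \<or> word_map w ` E \<inter> C = {}"
    using clopen_words[OF C(4,5,2)] by (metis order_refl)
  define W where "W = {w. w \<in> words \<Phi> n \<and> word_map w ` E \<subseteq> C}"
  have "W \<noteq> {}"
  proof -
    obtain w where "w \<in> words \<Phi> n" "y \<in> word_map w ` E" using E_words[of n] Q(2) by blast
    then show ?thesis using n[of w] C(1) by (auto simp: W_def)
  qed
  \<comment> \<open>The condition covers all clopen subsets of \<open>G\<close>, so it survives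
    cutting overlapping neighbourhoods into disjoint parts.\<close>
  define good where "good G \<longleftrightarrow> compact G \<and> compact (E - G) \<and> G \<subseteq> E \<and>
    (\<forall>F. compact F \<longrightarrow> compact (E - F) \<longrightarrow> F \<subseteq> G \<longrightarrow> \<mu> F \<in> I)" for G
  have local: "\<exists>V. open V \<and> x \<in> V \<and> good (V \<inter> E)" if x: "x \<in> E" for x
  proof -
    have "\<exists>v\<in>W. \<forall>v'\<in>words \<Phi> n. v' \<noteq> v \<longrightarrow> word_map v x \<notin> word_map v' ` E"
    proof (rule exists_free_word[OF x _ \<open>W \<noteq> {}\<close>])
      fix v v' assume v: "v \<in> W" "v' \<in> words \<Phi> n" "word_map v ` E \<inter> word_map v' ` E \<noteq> {}"
      then have "word_map v' ` E \<inter> C \<noteq> {}" unfolding W_def by blast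
      then show "v' \<in> W" using n[OF v(2)] v(2) by (simp add: W_def)
    qed (auto simp: W_def)
    then obtain v where v: "v \<in> words \<Phi> n" "word_map v ` E \<subseteq> C"
      and free: "\<And>v'. v' \<in> words \<Phi> n \<Longrightarrow> v' \<noteq> v \<Longrightarrow> word_map v x \<notin> word_map v' ` E"
      by (auto simp: W_def)
    \<comment> \<open>The other pieces of level \<open>n\<close>. They miss the image of
      \<open>x\<close>, hence also the image of a neighbourhood of \<open>x\<close>.\<close>
    define R where "R = (\<Union>v'\<in>words \<Phi> n - {v}. word_map v' ` E)"
    have "compact R" unfolding R_def
      using finite_words[OF finite_maps] compact_word_E wordsD(1) by (intro compact_UN) blast+
    then have "open (word_map v -` (- R))"
      using continuous_word[OF wordsD(1)[OF v(1)], of UNIV]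
      by (intro open_vimage) (auto simp: compact_imp_closed open_Compl)
    moreover have "x \<in> word_map v -` (- R)" using free by (auto simp: R_def)
    ultimately obtain G where G: "x \<in> G" "G \<subseteq> E" "G \<subseteq> word_map v -` (- R)" "compact G" "compact (E - G)"
      using clopen_neighbourhood[OF compact_E td x] by metis
    have "good G" unfolding good_def
    proof (intro conjI allI impI G)
      fix F assume F: "compact F" "compact (E - F)" "F \<subseteq> G"
      then have FE: "F \<subseteq> E" using G(2) by blast
      have disj: "word_map v ` F \<inter> word_map v' ` E = {}" if "v' \<in> words \<Phi> n" "v' \<noteq> v" for v'
        using F(3) G(3) that unfolding R_def by blast
      note im = \<mu>_word_image[OF F(1,2) FE v(1) disj]
      have "word_map v ` F \<subseteq> C" using FE v(2) by blast
      then have "\<mu> (word_map v ` F) \<in> I" using C by (intro gen[OF im(1,2) _ Q(1)]) auto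
      then show "\<mu> F \<in> I" using unit[OF wordsD(1)[OF v(1)]] im(3) by simp
    qed
    moreover have "open (- (E - G))" by (rule open_Compl[OF compact_imp_closed[OF G(5)]])
    moreover have "- (E - G) \<inter> E = G" using G(2) by blast
    ultimately show ?thesis using G(1) by (intro exI[of _ "- (E - G)"]) auto
  qed
  then obtain V where V: "\<And>x. x \<in> E \<Longrightarrow> open (V x)" "\<And>x. x \<in> E \<Longrightarrow> x \<in> V x" "\<And>x. x \<in> E \<Longrightarrow> good (V x \<inter> E)"
    by metis
  have "E \<subseteq> (\<Union>x\<in>E. V x)" using V(2) by blast
  from compactE_image[OF compact_E V(1) this]
  obtain J where J: "J \<subseteq> E" "finite J" "E \<subseteq> (\<Union>x\<in>J. V x)" .
  have good_Un: "good (A \<union> B)" if A: "good A" and B: "good B" for A B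
    unfolding good_def
  proof (intro conjI allI impI)
    show "compact (A \<union> B)" "A \<union> B \<subseteq> E" using A B by (auto simp: good_def)
    have "E - (A \<union> B) = (E - A) \<inter> (E - B)" by blast
    then show "compact (E - (A \<union> B))" using A B by (simp add: good_def compact_Int)
    fix F assume F: "compact F" "compact (E - F)" "F \<subseteq> A \<union> B"
    have AE: "A \<subseteq> E" "B \<subseteq> E" using A B by (auto simp: good_def)
    have "compact (F \<inter> A)" using F A by (auto simp: good_def compact_Int)
    moreover have "E - F \<inter> A = (E - F) \<union> (E - A)" by blast
    then have "compact (E - F \<inter> A)" using F A by (simp add: good_def compact_Un)
    moreover have "F - A = F \<inter> (E - A)" "E - (F - A) = (E - F) \<union> A" using F AE by blast+
    then have "compact (F - A)" "compact (E - (F - A))" using F A by (simp_all add: good_def compact_Un compact_Int)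
    ultimately have "\<mu> (F \<inter> A) \<in> I" "\<mu> (F - A) \<in> I" "\<mu> ((F \<inter> A) \<union> (F - A)) = \<mu> (F \<inter> A) + \<mu> (F - A)"
      using A B F AE by (auto simp: good_def intro!: \<mu>_Un)
    then show "\<mu> F \<in> I" using add by (simp add: Un_Diff_Int Int_Diff_Un)
  qed
  have "good {}" using zero compact_E by (auto simp: good_def \<mu>_def)
  have "good (\<Union>x\<in>J. V x \<inter> E)" using J(2,1)
  proof (induction J)
    case (insert x J)
    then show ?case using good_Un[OF V(3)[of x]] by simp
  qed (use \<open>good {}\<close> in simp)
  moreover have "(\<Union>x\<in>J. V x \<inter> E) = E" using J(3) by blast
  ultimately have "good E" by simp
  then have "\<mu> E \<in> I" using compact_E by (simp add: good_def)
  then show ?thesis by (simp add: \<mu>_E)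
qed

end

section \<open>Passing from lists to sets of maps, and the Moran exponent\<close>

lemma osc_set_distinct: "osc_set S U \<Longrightarrow> distinct S"
  unfolding osc_set_def distinct_conv_nth by (metis Int_absorb image_is_empty)

text \<open>\<open>osc_set\<close> compares indices, \<open>osc_open\<close> compares maps.
  Distinctness is supplied by \<open>osc_set_distinct\<close>: a repeated map would give a nonempty
  image disjoint from itself.\<close>

lemma osc_set_iff:
  assumes "distinct S"
  shows "osc_set S U \<longleftrightarrow> osc_open (set S) U"
proof
  assume U: "osc_set S U"
  have "f ` U \<inter> g ` U = {}" if "f \<in> set S" "g \<in> set S" "f \<noteq> g" for f g
    using U that unfolding osc_set_def by (metis in_set_conv_nth)
  moreover have "f ` U \<subseteq> U" if "f \<in> set S" for f
    using U that unfolding osc_set_def by (metis in_set_conv_nth)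
  ultimately show "osc_open (set S) U" using U unfolding osc_open_def osc_set_def by blast
next
  assume "osc_open (set S) U"
  then show "osc_set S U"
    using assms unfolding osc_open_def osc_set_def by (metis nth_eq_iff_index_eq nth_mem)
qed

text \<open>The sum is continuous in the exponent, equals the number of maps at \<open>0\<close> and
  tends to \<open>0\<close> at infinity.\<close>

lemma similarity_dimension_exists:
  fixes c :: "'b \<Rightarrow> real"
  assumes "finite A" "2 \<le> card A" "\<And>x. x \<in> A \<Longrightarrow> 0 < c x \<and> c x < 1"
  obtains s where "0 < s" "(\<Sum>x\<in>A. c x powr s) = 1"
proof -
  define h where "h t = (\<Sum>x\<in>A. c x powr t)" for t
  have "((\<lambda>t. c x powr t) \<longlongrightarrow> 0) at_top" if "x \<in> A" for x
  proof -
    have "ln (c x) < 0" using assms(3)[OF that] by simp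
    then have "filterlim (\<lambda>t. ln (c x) * t) at_bot at_top"
      by (intro filterlim_tendsto_neg_mult_at_bot[OF tendsto_const] filterlim_ident)
    then have "((\<lambda>t. exp (ln (c x) * t)) \<longlongrightarrow> 0) at_top" by (rule filterlim_compose[OF exp_at_bot])
    then show ?thesis using assms(3)[OF that] by (simp add: powr_def mult.commute)
  qed
  then have "(h \<longlongrightarrow> (\<Sum>x\<in>A. 0)) at_top" unfolding h_def by (rule tendsto_sum)
  then have "\<forall>\<^sub>F t in at_top. h t < 1" by (intro order_tendstoD) auto
  then obtain t where t: "0 < t" "h t < 1"
    using eventually_conj[OF _ eventually_gt_at_top[of 0]] eventually_happens'[of "at_top :: real filter"]
    by (metis (mono_tags, lifting) trivial_limit_at_top_linorder)
  have "h 0 = card A" unfolding h_def using assms(3) by (simp add: powr_def less_imp_neq[symmetric] cong: sum.cong)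
  then have "1 < h 0" using assms(2) by simp
  have "continuous_on {0..t} h" unfolding h_def
    using assms(3) by (intro continuous_intros) force
  then obtain s where "0 \<le> s" "s \<le> t" "h s = 1"
    using IVT2'[of h t 1 0] t \<open>1 < h 0\<close> by auto
  moreover have "s \<noteq> 0" using \<open>h s = 1\<close> \<open>1 < h 0\<close> by auto
  ultimately show ?thesis using that[of s] by (simp add: h_def)
qed

section \<open>The ring generated by \<open>p\<close>, and the conclusion\<close>

lemma int_adjoin_simps [simp]:
  "mult (int_adjoin p) = (*)" "add (int_adjoin p) = (+)" "one (int_adjoin p) = 1" "zero (int_adjoin p) = 0"
  by (simp_all add: int_adjoin_def ring_of_type_algebra_def)

lemma subring_int_adjoin: "subring (carrier (int_adjoin p)) (ring_of_type_algebra :: real ring)"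
proof -
  interpret ring "ring_of_type_algebra :: real ring" by (rule ring_from_type_algebra)
  show ?thesis unfolding int_adjoin_def
    by simp (rule generate_ring_is_subring, simp add: ring_of_type_algebra_def)
qed

lemma ring_int_adjoin: "ring (int_adjoin p)"
proof -
  interpret ring "ring_of_type_algebra :: real ring" by (rule ring_from_type_algebra)
  show ?thesis using subring_is_ring[OF subring_int_adjoin[of p]] by (simp add: int_adjoin_def)
qed

lemma int_adjoin_closed:
  "p \<in> carrier (int_adjoin p)" "0 \<in> carrier (int_adjoin p)" "1 \<in> carrier (int_adjoin p)"
  "a \<in> carrier (int_adjoin p) \<Longrightarrow> b \<in> carrier (int_adjoin p) \<Longrightarrow> a + b \<in> carrier (int_adjoin p)"
  "a \<in> carrier (int_adjoin p) \<Longrightarrow> b \<in> carrier (int_adjoin p) \<Longrightarrow> a * b \<in> carrier (int_adjoin p)"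
proof -
  interpret R: ring "int_adjoin p" by (rule ring_int_adjoin)
  show "p \<in> carrier (int_adjoin p)" by (simp add: int_adjoin_def generate_ring.incl)
  show "0 \<in> carrier (int_adjoin p)" using R.zero_closed by simp
  show "1 \<in> carrier (int_adjoin p)" using R.one_closed by simp
  show "a + b \<in> carrier (int_adjoin p)" if "a \<in> carrier (int_adjoin p)" "b \<in> carrier (int_adjoin p)"
    using R.a_closed[OF that] by simp
  show "a * b \<in> carrier (int_adjoin p)" if "a \<in> carrier (int_adjoin p)" "b \<in> carrier (int_adjoin p)"
    using R.m_closed[OF that] by simp
qed

lemma int_adjoin_power: "a \<in> carrier (int_adjoin p) \<Longrightarrow> a ^ n \<in> carrier (int_adjoin p)"
  by (induction n) (auto intro: int_adjoin_closed)

lemma int_adjoin_sum: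
  "(\<And>x. x \<in> A \<Longrightarrow> f x \<in> carrier (int_adjoin p)) \<Longrightarrow> sum f A \<in> carrier (int_adjoin p)"
  by (induction A rule: infinite_finite_induct) (auto intro: int_adjoin_closed)

lemma measure_ideal_eq_carrier:
  fixes S :: "(real^'n) ifs"
  assumes "S \<in> convex_orthogonal_class"
  shows "measure_ideal S = carrier (int_adjoin (ratio_power S))"
proof -
  from assms have ifs: "is_ifs S" and comm: "commensurable_ratios S" and td: "totally_disconnected (attractor S)"
    and conv: "convex_open_set_condition S" and orth: "orthogonal_homogeneous S"
    by (auto simp: convex_orthogonal_class_def TDC_OSC1_def)
  obtain U where U: "osc_set S U" "convex U" using conv by (auto simp: convex_open_set_condition_def)
  have dist: "distinct S" using U(1) by (rule osc_set_distinct)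
  define \<Phi> where "\<Phi> = set S"
  have osc: "osc_open \<Phi> U" using U(1) osc_set_iff[OF dist] by (simp add: \<Phi>_def)
  have ratio: "0 < ratio f \<and> ratio f < 1 \<and> similarity_with (ratio f) f" if "f \<in> \<Phi>" for f
    using ifs that ratio_eq unfolding is_ifs_def \<Phi>_def by blast
  have card: "2 \<le> card \<Phi>" using ifs dist by (simp add: is_ifs_def \<Phi>_def distinct_card)
  interpret similarities \<Phi>
    using ratio by unfold_locales (auto simp: \<Phi>_def)
  have "f ` closure U \<subseteq> closure U" if "f \<in> \<Phi>" for f
  proof (rule image_closure_subset)
    show "continuous_on (closure U) f" using similarity[OF that] by (rule similarity_continuous)
    show "f ` U \<subseteq> closure U" using that osc closure_subset by (fastforce simp: osc_open_def)
  qed simp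
  moreover have "compact (closure U)" "closure U \<noteq> {}" using osc by (auto simp: osc_open_def compact_closure)
  moreover have "\<Phi> \<noteq> {}" using card by auto
  ultimately obtain E where E: "compact E" "E \<noteq> {}" "E = (\<Union>f\<in>\<Phi>. f ` E)"
    using invariant_set_exists by metis
  have sub: "A \<subseteq> B" if "compact A" "A = (\<Union>f\<in>\<Phi>. f ` A)" "B \<noteq> {}" "compact B" "B = (\<Union>f\<in>\<Phi>. f ` B)" for A B
  proof (rule subset_invariant)
    show "A \<subseteq> (\<Union>f\<in>\<Phi>. f ` A)" using that(2) by (rule equalityD1)
    show "f ` B \<subseteq> B" if "f \<in> \<Phi>" for f using \<open>B = (\<Union>f\<in>\<Phi>. f ` B)\<close> that by blast
  qed (use that in \<open>auto simp: compact_imp_bounded compact_imp_closed\<close>)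
  have attr: "attractor S = E"
    unfolding attractor_def \<Phi>_def[symmetric]
  proof (rule the_equality)
    show "E \<noteq> {} \<and> compact E \<and> E = (\<Union>f\<in>\<Phi>. f ` E)" using E by (intro conjI)
    fix A assume A: "A \<noteq> {} \<and> compact A \<and> A = (\<Union>f\<in>\<Phi>. f ` A)"
    then have "A \<subseteq> E" "E \<subseteq> A" using E by (intro sub; blast)+
    then show "A = E" by (rule equalityI)
  qed
  obtain A :: "real^'n^'n" where A: "orthogonal_matrix A"
    and form: "\<And>f. f \<in> \<Phi> \<Longrightarrow> \<exists>r b. 0 < r \<and> r < 1 \<and> (\<forall>x. f x = r *\<^sub>R (A *v x) + b)"
    using orth unfolding orthogonal_homogeneous_def \<Phi>_def by blast
  have orth_mult: "orthogonal_transformation ((*v) B)" if "orthogonal_matrix B" for B :: "real^'n^'n"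
    using that by (simp add: orthogonal_transformation_matrix)
  obtain s where s: "0 < s" "(\<Sum>f\<in>\<Phi>. ratio f powr s) = 1"
    using similarity_dimension_exists[of \<Phi> ratio] card finite_maps ratio by blast
  interpret homogeneous_ifs_measure \<Phi> E "(*v) (transpose A)" U s
  proof unfold_locales
    show "orthogonal_transformation ((*v) (transpose A))"
      using A by (intro orth_mult) (simp add: orthogonal_matrix_transpose)
    fix f g x y assume f: "f \<in> \<Phi>"
    obtain r b where r: "0 < r" "\<And>x. f x = r *\<^sub>R (A *v x) + b" using form[OF f] by blast
    have diff: "f x - f y = r *\<^sub>R (A *v (x - y))" for x y
      by (simp add: r(2) matrix_vector_mult_diff_distrib scaleR_diff_right)
    have "similarity_with r f"
      using orthogonal_transformation_norm[OF orth_mult[OF A]] r(1)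
      by (simp add: similarity_with_def dist_norm diff)
    then have "ratio f = r" by (rule ratio_eq)
    then show "g \<bullet> (f x - f y) = ratio f * ((transpose A *v g) \<bullet> (x - y))"
      by (simp add: diff dot_lmul_matrix)
  qed (use E s osc U(2) in auto)
  have dim: "attractor_dim S = s" by (simp add: attractor_dim_def attr hausdorff_dim_E)
  have nat: "natural_measure S F = \<mu> F" for F by (simp add: natural_measure_def \<mu>_def attr dim)
  obtain r where root: "is_ratio_root S r" using comm by (auto simp: commensurable_ratios_def)
  define p where "p = ratio_power S"
  have p: "p = r powr s" by (simp add: p_def ratio_power_def dim ratio_root_eq[OF root])
  have "0 < r" using root by (simp add: is_ratio_root_def)
  then have "0 < p" by (simp add: p)
  have "\<exists>k>0. ratio f powr s = p ^ k" if f: "f \<in> \<Phi>" for f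
  proof -
    obtain k where k: "0 < k" "ratio f = r ^ k"
      using root f unfolding is_ratio_root_def \<Phi>_def by (metis in_set_conv_nth)
    have "ratio f powr s = p ^ k"
      using \<open>0 < r\<close> unfolding k(2) p by (simp add: powr_powr mult.commute flip: powr_realpow)
    then show ?thesis using k(1) by blast
  qed
  then obtain k where k: "\<And>f. f \<in> \<Phi> \<Longrightarrow> 0 < k f" "\<And>f. f \<in> \<Phi> \<Longrightarrow> ratio f powr s = p ^ k f" by metis
  have word: "\<exists>m. word_ratio w powr s = p ^ m" if "set w \<subseteq> \<Phi>" for w
    using that
  proof (induction w)
    case (Cons f w)
    then obtain m where "word_ratio w powr s = p ^ m" by auto
    then have "word_ratio (f # w) powr s = p ^ (k f + m)"
      using Cons.prems k(2)[of f] by (simp add: powr_mult power_add)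
    then show ?case by blast
  qed (auto intro: exI[of _ 0])
  \<comment> \<open>The inverse of \<open>p\<close> inside the ring: the Moran equation reads
    \<open>(\<Sum>f\<in>\<Phi>. p ^ k f) = 1\<close>, and one factor \<open>p\<close> can be taken
    out because all \<open>k f\<close> are positive.\<close>
  define q where "q = (\<Sum>f\<in>\<Phi>. p ^ (k f - 1))"
  have "p * p ^ (k f - 1) = p ^ k f" if "f \<in> \<Phi>" for f
    using k(1)[OF that] by (simp flip: power_Suc)
  then have "p * q = (\<Sum>f\<in>\<Phi>. p ^ k f)" by (simp add: q_def sum_distrib_left)
  also have "\<dots> = 1" using s(2) k(2) by simp
  finally have pq: "p * q = 1" .
  let ?R = "int_adjoin p"
  have q: "q \<in> carrier ?R" unfolding q_def by (intro int_adjoin_sum int_adjoin_power int_adjoin_closed)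
  interpret R: ring ?R by (rule ring_int_adjoin)
  define gens where "gens = {natural_measure S F | F. interior_separated S F}"
  \<comment> \<open>This makes the whole ring one of the ideals containing the generators, so that
    the intersection defining \<open>genideal\<close> ranges over a nonempty family.\<close>
  have gens: "gens \<subseteq> carrier ?R"
  proof
    fix a assume "a \<in> gens"
    then obtain F where F: "a = \<mu> F" "compact F" "compact (E - F)" "F \<subseteq> E"
      by (auto simp: gens_def nat interior_separated_def attr)
    from \<mu>_clopen_eq_sum[OF F(2-4)] obtain n
      where "\<mu> F = (\<Sum>w | w \<in> words \<Phi> n \<and> word_map w ` E \<subseteq> F. word_ratio w powr s)" .
    moreover have "word_ratio w powr s \<in> carrier ?R" if "w \<in> words \<Phi> n" for w
      using word[OF wordsD(1)[OF that]] int_adjoin_power int_adjoin_closed(1) by metis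
    ultimately show "a \<in> carrier ?R" using F(1) by (auto intro!: int_adjoin_sum)
  qed
  have full: "J = carrier ?R" if J: "ideal J ?R" and sub: "gens \<subseteq> J" for J
  proof -
    interpret ideal J ?R by (rule J)
    have "1 \<in> J"
    proof (rule one_in_ideal)
      show "totally_disconnected E" using td by (simp add: attr)
      show "0 \<in> J" using zero_closed by simp
      show "a + b \<in> J" if "a \<in> J" "b \<in> J" for a b using a_closed[OF that] by simp
      show "a \<in> J" if w: "set w \<subseteq> \<Phi>" and a: "word_ratio w powr s * a \<in> J" for w a
      proof -
        obtain m where m: "word_ratio w powr s = p ^ m" using word[OF w] by blast
        have "q ^ m * (p ^ m * a) \<in> J"
          using I_l_closed[OF a int_adjoin_power[OF q, of m]] by (simp add: m)
        moreover have "q ^ m * (p ^ m * a) = (p * q) ^ m * a" by (simp add: power_mult_distrib)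
        ultimately show ?thesis by (simp add: pq)
      qed
      show "\<mu> F \<in> J" if "compact F" "compact (E - F)" "F \<subseteq> E" "osc_open \<Phi> Q" "F \<subseteq> Q" for F Q
      proof -
        have "interior_separated S F"
          using that osc_set_iff[OF dist] by (auto simp: interior_separated_def attr \<Phi>_def)
        then show ?thesis using sub nat unfolding gens_def by (metis (mono_tags, lifting) mem_Collect_eq subsetD)
      qed
    qed
    then show ?thesis by (intro one_imp_carrier) simp
  qed
  have "genideal ?R gens = carrier ?R"
  proof -
    have "{J. ideal J ?R \<and> gens \<subseteq> J} = {carrier ?R}" using full gens R.oneideal by blast
    then show ?thesis by (simp add: genideal_def)
  qed
  then show ?thesis by (simp add: measure_ideal_def gens_def p_def)
qed

theorem theorem1p7:
  shows "(\<forall>S \<in> (convex_orthogonal_class :: (real^'n) ifs set).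
            measure_ideal S = carrier (int_adjoin (ratio_power S)))
       \<and> (convex_orthogonal_class :: (real^'n) ifs set) \<subseteq> PI_class"
proof (intro conjI ballI subsetI)
  fix S :: "(real^'n) ifs"
  assume S: "S \<in> convex_orthogonal_class"
  show "measure_ideal S = carrier (int_adjoin (ratio_power S))"
    by (rule measure_ideal_eq_carrier[OF S])
next
  fix S :: "(real^'n) ifs"
  assume S: "S \<in> convex_orthogonal_class"
  then show "S \<in> PI_class"
    using ring.onepideal[OF ring_int_adjoin] measure_ideal_eq_carrier[OF S]
    by (simp add: PI_class_def convex_orthogonal_class_def)
qed

end
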